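(* $\mathrm{RCA}_0+\mathrm{B}\Sigma^0_2\vdash\mathrm{FinCOH}$; that is, the finite cohesiveness principle is provable in $\mathrm{RCA}_0$ together with the collection scheme for $\Sigma^0_2$ formulas.
   Context: We work in the two-sorted language of second-order arithmetic (numbers and sets); a model is a pair $(M,\mathcal{X})$ with $M$ the first-order part and $\mathcal{X}$ a family of subsets of $M$. $\mathbb{N}$ denotes the set of all numbers as formalized inside the theory (interpreted as $M$). $\Sigma^0_n,\Pi^0_n$ are the usual classes of formulas counted by alternating blocks of first-order quantifiers, with first- and second-order parameters allowed and no second-order quantifiers; $\Delta^0_n$ means given by both a $\Sigma^0_n$ and a $\Pi^0_n$ formula. $\mathrm{RCA}_0$ consists of Robinson arithmetic, the induction scheme $\mathrm{I}\Sigma^0_1$ for $\Sigma^0_1$ formulas, and comprehension for $\Delta^0_1$ formulas. $\mathrm{B}\Sigma^0_2$ is the collection scheme $\forall a\,[\forall x<a\,\exists y\,\varphi(x,y)\to\exists b\,\forall x<a\,\exists y<b\,\varphi(x,y)]$ for $\Sigma^0_2$ formulas $\varphi$ (with parameters). $A\subseteq^* B$ means $\exists b\,\forall x>b\,(x\in A\to x\in B)$. $A^c$ is the complement of $A$. A set is infinite if it is unbounded in $\mathbb{N}$. With a standard pairing function $\langle\cdot,\cdot\rangle$, a set $R$ is viewed as a sequence of sets by $R_k=\{x : \langle k,x\rangle\in R\}$. $\mathrm{FinCOH}$ (finite cohesiveness principle): for every $\ell\in\mathbb{N}$ and every sequence of sets $R=(R_k)_{k<\ell}$ of length $\ell$,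 there is an infinite set $H$ such that for every $k<\ell$, either $H\subseteq^* R_k$ or $H\subseteq^* R_k^c$. (Here $\ell$ ranges over all, possibly nonstandard, numbers of the model.) *)

theory Defs
  imports Main
begin

text \<open>
  Syntax of the two-sorted language of second-order arithmetic, with de Bruijn indices.  Number
  variables and set variables are indexed separately, and a quantifier of one sort does not
  affect the indices of the other sort.  As usual, equality is primitive for numbers only.
\<close>

datatype tm = Var nat | Zero | Succ tm | Add tm tm | Mul tm tm

datatype fm =
    Falsum
  | Eq tm tm       (infix \<open>\<^bold>=\<close> 55)
  | Less tm tm     (infix \<open>\<^bold><\<close> 55)
  | Mem tm nat     (infix \<open>\<^bold>\<in>\<close> 55)
  | Imp fm fm      (infixr \<open>\<^bold>\<longrightarrow>\<close> 45)
  | All fm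
  | AllSet fm

abbreviation Neg :: "fm \<Rightarrow> fm" (\<open>\<^bold>\<not> _\<close> [50] 50) where
  "\<^bold>\<not> \<phi> \<equiv> \<phi> \<^bold>\<longrightarrow> Falsum"

abbreviation Or :: "fm \<Rightarrow> fm \<Rightarrow> fm" (infixr \<open>\<^bold>\<or>\<close> 47) where
  "\<phi> \<^bold>\<or> \<psi> \<equiv> \<^bold>\<not> \<phi> \<^bold>\<longrightarrow> \<psi>"

abbreviation And :: "fm \<Rightarrow> fm \<Rightarrow> fm" (infixr \<open>\<^bold>\<and>\<close> 48) where
  "\<phi> \<^bold>\<and> \<psi> \<equiv> \<^bold>\<not> (\<phi> \<^bold>\<longrightarrow> \<^bold>\<not> \<psi>)"

abbreviation Iff :: "fm \<Rightarrow> fm \<Rightarrow> fm" (infix \<open>\<^bold>\<longleftrightarrow>\<close> 44) where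
  "\<phi> \<^bold>\<longleftrightarrow> \<psi> \<equiv> (\<phi> \<^bold>\<longrightarrow> \<psi>) \<^bold>\<and> (\<psi> \<^bold>\<longrightarrow> \<phi>)"

abbreviation Ex :: "fm \<Rightarrow> fm" where
  "Ex \<phi> \<equiv> \<^bold>\<not> All (\<^bold>\<not> \<phi>)"

abbreviation ExSet :: "fm \<Rightarrow> fm" where
  "ExSet \<phi> \<equiv> \<^bold>\<not> AllSet (\<^bold>\<not> \<phi>)"

text \<open>
  Simultaneous capture-avoiding substitution of terms for number variables and of set variables
  for set variables.
\<close>

primrec subst_tm :: "(nat \<Rightarrow> tm) \<Rightarrow> tm \<Rightarrow> tm" where
  "subst_tm \<sigma> (Var n) = \<sigma> n"
| "subst_tm \<sigma> Zero = Zero"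
| "subst_tm \<sigma> (Succ t) = Succ (subst_tm \<sigma> t)"
| "subst_tm \<sigma> (Add s t) = Add (subst_tm \<sigma> s) (subst_tm \<sigma> t)"
| "subst_tm \<sigma> (Mul s t) = Mul (subst_tm \<sigma> s) (subst_tm \<sigma> t)"

definition shift_tm :: "tm \<Rightarrow> tm" where
  "shift_tm = subst_tm (\<lambda>n. Var (Suc n))"

primrec subst :: "(nat \<Rightarrow> tm) \<Rightarrow> (nat \<Rightarrow> nat) \<Rightarrow> fm \<Rightarrow> fm" where
  "subst \<sigma> \<rho> Falsum = Falsum"
| "subst \<sigma> \<rho> (s \<^bold>= t) = (subst_tm \<sigma> s \<^bold>= subst_tm \<sigma> t)"
| "subst \<sigma> \<rho> (s \<^bold>< t) = (subst_tm \<sigma> s \<^bold>< subst_tm \<sigma> t)"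
| "subst \<sigma> \<rho> (t \<^bold>\<in> X) = (subst_tm \<sigma> t \<^bold>\<in> \<rho> X)"
| "subst \<sigma> \<rho> (\<phi> \<^bold>\<longrightarrow> \<psi>) = (subst \<sigma> \<rho> \<phi> \<^bold>\<longrightarrow> subst \<sigma> \<rho> \<psi>)"
| "subst \<sigma> \<rho> (All \<phi>) = All (subst (case_nat (Var 0) (\<lambda>n. shift_tm (\<sigma> n))) \<rho> \<phi>)"
| "subst \<sigma> \<rho> (AllSet \<phi>) = AllSet (subst \<sigma> (case_nat 0 (\<lambda>n. Suc (\<rho> n))) \<phi>)"

definition shift :: "fm \<Rightarrow> fm" where
  "shift = subst (\<lambda>n. Var (Suc n)) id"

definition shift_set :: "fm \<Rightarrow> fm" where
  "shift_set = subst Var Suc"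

definition inst :: "fm \<Rightarrow> tm \<Rightarrow> fm" where
  "inst \<phi> t = subst (case_nat t Var) id \<phi>"

definition inst_set :: "fm \<Rightarrow> nat \<Rightarrow> fm" where
  "inst_set \<phi> X = subst Var (case_nat X id) \<phi>"

text \<open>
  A Hilbert calculus for two-sorted classical logic with equality on the number sort (Mendelson's
  system, with double negation elimination for its third axiom).  Since generalization is
  unrestricted, axioms in \<open>T\<close> with free variables stand for their universal closures.
\<close>

inductive derives :: "fm set \<Rightarrow> fm \<Rightarrow> bool" (infix \<open>\<turnstile>\<close> 40) for T :: "fm set" where
  Axiom: "\<phi> \<in> T \<Longrightarrow> T \<turnstile> \<phi>"
| K: "T \<turnstile> \<phi> \<^bold>\<longrightarrow> \<psi> \<^bold>\<longrightarrow> \<phi>"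
| S: "T \<turnstile> (\<phi> \<^bold>\<longrightarrow> \<psi> \<^bold>\<longrightarrow> \<chi>) \<^bold>\<longrightarrow> (\<phi> \<^bold>\<longrightarrow> \<psi>) \<^bold>\<longrightarrow> \<phi> \<^bold>\<longrightarrow> \<chi>"
| DNE: "T \<turnstile> \<^bold>\<not> (\<^bold>\<not> \<phi>) \<^bold>\<longrightarrow> \<phi>"
| All_inst: "T \<turnstile> All \<phi> \<^bold>\<longrightarrow> inst \<phi> t"
| All_imp: "T \<turnstile> All (shift \<phi> \<^bold>\<longrightarrow> \<psi>) \<^bold>\<longrightarrow> \<phi> \<^bold>\<longrightarrow> All \<psi>"
| AllSet_inst: "T \<turnstile> AllSet \<phi> \<^bold>\<longrightarrow> inst_set \<phi> X"
| AllSet_imp: "T \<turnstile> AllSet (shift_set \<phi> \<^bold>\<longrightarrow> \<psi>) \<^bold>\<longrightarrow> \<phi> \<^bold>\<longrightarrow> AllSet \<psi>"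
| Eq_refl: "T \<turnstile> t \<^bold>= t"
| Eq_subst: "T \<turnstile> s \<^bold>= t \<^bold>\<longrightarrow> inst \<phi> s \<^bold>\<longrightarrow> inst \<phi> t"
| MP: "T \<turnstile> \<phi> \<^bold>\<longrightarrow> \<psi> \<Longrightarrow> T \<turnstile> \<phi> \<Longrightarrow> T \<turnstile> \<psi>"
| Gen: "T \<turnstile> \<phi> \<Longrightarrow> T \<turnstile> All \<phi>"
| Gen_set: "T \<turnstile> \<phi> \<Longrightarrow> T \<turnstile> AllSet \<phi>"

text \<open>
  Bounded quantifiers: the bound is a term of the outer context, so the quantified variable does
  not occur in it.
\<close>

definition BAll :: "tm \<Rightarrow> fm \<Rightarrow> fm" where
  "BAll t \<phi> = All (Var 0 \<^bold>< shift_tm t \<^bold>\<longrightarrow> \<phi>)"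

definition BEx :: "tm \<Rightarrow> fm \<Rightarrow> fm" where
  "BEx t \<phi> = Ex (Var 0 \<^bold>< shift_tm t \<^bold>\<and> \<phi>)"

inductive bounded :: "fm \<Rightarrow> bool" where
  "bounded Falsum"
| "bounded (s \<^bold>= t)"
| "bounded (s \<^bold>< t)"
| "bounded (t \<^bold>\<in> X)"
| "bounded \<phi> \<Longrightarrow> bounded \<psi> \<Longrightarrow> bounded (\<phi> \<^bold>\<longrightarrow> \<psi>)"
| "bounded \<phi> \<Longrightarrow> bounded (BAll t \<phi>)"
| "bounded \<phi> \<Longrightarrow> bounded (BEx t \<phi>)"

inductive Sigma0 :: "nat \<Rightarrow> fm \<Rightarrow> bool" and Pi0 :: "nat \<Rightarrow> fm \<Rightarrow> bool" where
  "bounded \<phi> \<Longrightarrow> Sigma0 0 \<phi>"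
| "Pi0 n \<phi> \<Longrightarrow> Sigma0 (Suc n) \<phi>"
| "Sigma0 (Suc n) \<phi> \<Longrightarrow> Sigma0 (Suc n) (Ex \<phi>)"
| "bounded \<phi> \<Longrightarrow> Pi0 0 \<phi>"
| "Sigma0 n \<phi> \<Longrightarrow> Pi0 (Suc n) \<phi>"
| "Pi0 (Suc n) \<phi> \<Longrightarrow> Pi0 (Suc n) (All \<phi>)"

definition Robinson :: "fm set" where
  "Robinson =
    {\<^bold>\<not> Succ (Var 0) \<^bold>= Zero,
     Succ (Var 0) \<^bold>= Succ (Var 1) \<^bold>\<longrightarrow> Var 0 \<^bold>= Var 1,
     \<^bold>\<not> Var 0 \<^bold>= Zero \<^bold>\<longrightarrow> Ex (Var 1 \<^bold>= Succ (Var 0)),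
     Add (Var 0) Zero \<^bold>= Var 0,
     Add (Var 0) (Succ (Var 1)) \<^bold>= Succ (Add (Var 0) (Var 1)),
     Mul (Var 0) Zero \<^bold>= Zero,
     Mul (Var 0) (Succ (Var 1)) \<^bold>= Add (Mul (Var 0) (Var 1)) (Var 0),
     Var 0 \<^bold>< Var 1 \<^bold>\<longleftrightarrow> Ex (Add (Succ (Var 0)) (Var 1) \<^bold>= Var 2)}"

text \<open>
  In the schemes below, all variables of \<open>\<phi>\<close> and \<open>\<psi>\<close> other than the displayed ones are first- and
  second-order parameters.  In induction and comprehension \<open>\<phi>\<close> and \<open>\<psi>\<close> have number variable 0 as
  their distinguished variable.
\<close>

definition induction :: "fm \<Rightarrow> fm" where
  "induction \<phi> =
    (inst \<phi> Zero \<^bold>\<longrightarrow>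
     All (\<phi> \<^bold>\<longrightarrow> subst (case_nat (Succ (Var 0)) (\<lambda>n. Var (Suc n))) id \<phi>) \<^bold>\<longrightarrow>
     All \<phi>)"

definition Delta_comprehension :: "fm \<Rightarrow> fm \<Rightarrow> fm" where
  "Delta_comprehension \<phi> \<psi> =
    (All (\<phi> \<^bold>\<longleftrightarrow> \<psi>) \<^bold>\<longrightarrow> ExSet (All (Var 0 \<^bold>\<in> 0 \<^bold>\<longleftrightarrow> shift_set \<phi>)))"

definition RCA0 :: "fm set" where
  "RCA0 = Robinson \<union> {induction \<phi> | \<phi>. Sigma0 1 \<phi>}
      \<union> {Delta_comprehension \<phi> \<psi> | \<phi> \<psi>. Sigma0 1 \<phi> \<and> Pi0 1 \<psi>}"

text \<open>
  In collection \<open>\<phi>\<close> has \<open>y\<close> as number variable 0, \<open>x\<close> as number variable 1 and its parameters from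
  index 2 on.  The parameters are renamed past the quantifier over \<open>a\<close> in the premise, and past
  those over \<open>a\<close> and \<open>b\<close> in the conclusion.
\<close>

definition collection :: "fm \<Rightarrow> fm" where
  "collection \<phi> =
    All (BAll (Var 0)
          (Ex (subst (\<lambda>n. Var (if n < 2 then n else n + 1)) id \<phi>)) \<^bold>\<longrightarrow>
         Ex (BAll (Var 1) (BEx (Var 1)
          (subst (\<lambda>n. Var (if n < 2 then n else n + 2)) id \<phi>))))"

definition BSigma0 :: "nat \<Rightarrow> fm set" where
  "BSigma0 n = {collection \<phi> | \<phi>. Sigma0 n \<phi>}"

text \<open>
  The pairing function \<open>\<langle>k, x\<rangle> = (k + x)\<^sup>2 + k\<close> customary in second-order arithmetic, which is a term
  of the language.
\<close>

definition pair :: "tm \<Rightarrow> tm \<Rightarrow> tm" where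
  "pair k x = Add (Mul (Add k x) (Add k x)) k"

definition infinite_set :: "nat \<Rightarrow> fm" where
  "infinite_set X = All (Ex (Var 1 \<^bold>< Var 0 \<^bold>\<and> Var 0 \<^bold>\<in> X))"

text \<open>
  Almost inclusion of \<open>{x. \<phi>}\<close> in \<open>{x. \<psi>}\<close>: here \<open>x\<close> is number variable 0 of \<open>\<phi>\<close> and \<open>\<psi>\<close>, number
  variable 1 is the bound \<open>b\<close>, and number variables from 2 on refer to the context.
\<close>

definition almost_subset :: "fm \<Rightarrow> fm \<Rightarrow> fm" where
  "almost_subset \<phi> \<psi> = Ex (All (Var 1 \<^bold>< Var 0 \<^bold>\<longrightarrow> (\<phi> \<^bold>\<longrightarrow> \<psi>)))"

text \<open>
  In the body of \<open>FinCOH\<close>, the length \<open>\<ell>\<close> is number variable 0, \<open>H\<close> is set variable 0 and \<open>R\<close> is set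
  variable 1; inside \<open>almost_subset\<close>, number variable 2 is \<open>k\<close>.
\<close>

definition FinCOH :: fm where
  "FinCOH =
    All (AllSet (ExSet
      (infinite_set 0 \<^bold>\<and>
       BAll (Var 0)
        (almost_subset (Var 0 \<^bold>\<in> 0) (pair (Var 2) (Var 0) \<^bold>\<in> 1) \<^bold>\<or>
         almost_subset (Var 0 \<^bold>\<in> 0) (\<^bold>\<not> pair (Var 2) (Var 0) \<^bold>\<in> 1)))))"

end

theory Submission
  imports Defs "HOL-Library.Countable_Set"
begin

text \<open>
  By completeness it suffices to argue in a model.  Colour each number \<open>x\<close> with the finite set
  \<open>{k < \<ell>. x \<in> R\<^sub>k}\<close>.  In \<open>RCA\<^sub>0\<close> these sets have codes below a bound that does not depend on \<open>x\<close>: take a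
  multiple \<open>m\<close> of \<open>1, \<dots>, \<ell>\<close>, use the pairwise coprime moduli \<open>1 + (k + 1) m\<close>, and let divisibility by
  the \<open>k\<close>-th modulus express membership of \<open>k\<close>.  If every code occurred only boundedly often, then
  collection would bound all these occurrences at once, leaving no colour for a number beyond the
  common bound.  So some code occurs unboundedly often, and the set of the numbers having it is even
  homogeneous for every \<open>R\<^sub>k\<close>.
\<close>

section \<open>Substitution\<close>

text \<open>The length \<open>\<ell>\<close> may be nonstandard, so the pigeonhole argument over all
  colours cannot be an external finite one, and neither exponentiation nor coded sequences are
  developed here. A colour is a single number tested for divisors. A nonzero common multiple
  \<open>C\<close> of the moduli, obtained by \<open>\<Sigma>\<^sub>1\<close> induction, bounds all
  codes at once, because a code is a least common multiple. Divisibility is a bounded condition, so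
  "no number beyond \<open>a\<close> has code \<open>c\<close>" is \<open>\<Pi>\<^sub>1\<close> in
  \<open>a\<close> and \<open>c\<close>; this is why the pigeonhole step calls for collection at the
  level \<open>\<Sigma>\<^sub>2\<close>. The models considered all have \<open>nat\<close> as
  carrier, since a premise of a theorem cannot quantify over types.\<close>

lemma subst_tm_subst_tm: "subst_tm \<sigma> (subst_tm \<tau> t) = subst_tm (\<lambda>n. subst_tm \<sigma> (\<tau> n)) t"
  by (induction t) auto

lemma subst_tm_Var [simp]: "subst_tm Var t = t"
  by (induction t) auto

lemma case_nat_Var [simp]: "case_nat (Var 0) (\<lambda>n. Var (Suc n)) = Var"
  by (auto simp: fun_eq_iff split: nat.split)

lemma case_nat_Suc [simp]: "case_nat 0 (\<lambda>n. Suc (id n)) = id"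
  by (auto simp: fun_eq_iff split: nat.split)

lemma subst_Var [simp]: "subst Var id \<phi> = \<phi>"
  by (induction \<phi>) (auto simp: shift_tm_def simp del: id_apply, simp_all)

lemma subst_tm_case_nat_shift_tm [simp]: "subst_tm (case_nat t \<sigma>) (shift_tm s) = subst_tm \<sigma> s"
  by (simp add: shift_tm_def subst_tm_subst_tm)

lemma subst_subst:
  "subst \<sigma> \<rho> (subst \<tau> \<pi> \<phi>) = subst (\<lambda>n. subst_tm \<sigma> (\<tau> n)) (\<lambda>n. \<rho> (\<pi> n)) \<phi>"
proof (induction \<phi> arbitrary: \<sigma> \<rho> \<tau> \<pi>)
  case (All \<phi>)
  have "(\<lambda>n. subst_tm (case_nat (Var 0) (\<lambda>n. shift_tm (\<sigma> n))) (case_nat (Var 0) (\<lambda>n. shift_tm (\<tau> n)) n))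
      = case_nat (Var 0) (\<lambda>n. shift_tm (subst_tm \<sigma> (\<tau> n)))"
    by (auto simp: fun_eq_iff split: nat.split)
      (simp add: shift_tm_def subst_tm_subst_tm)
  then show ?case by (simp add: All)
next
  case (AllSet \<phi>)
  have "(\<lambda>n. case_nat 0 (\<lambda>n. Suc (\<rho> n)) (case_nat 0 (\<lambda>n. Suc (\<pi> n)) n)) = case_nat 0 (\<lambda>n. Suc (\<rho> (\<pi> n)))"
    by (auto simp: fun_eq_iff split: nat.split)
  then show ?case by (simp add: AllSet)
qed (auto simp: subst_tm_subst_tm)

lemma inst_subst_All:
  "inst (subst (case_nat (Var 0) (\<lambda>n. shift_tm (\<sigma> n))) \<rho> \<phi>) t = subst (case_nat t \<sigma>) \<rho> \<phi>"
proof -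
  have "(\<lambda>n. subst_tm (case_nat t Var) (case_nat (Var 0) (\<lambda>n. shift_tm (\<sigma> n)) n)) = case_nat t \<sigma>"
    by (auto simp: fun_eq_iff split: nat.split)
  then show ?thesis by (simp add: inst_def subst_subst)
qed

lemma inst_set_subst_AllSet:
  "inst_set (subst \<sigma> (case_nat 0 (\<lambda>n. Suc (\<rho> n))) \<phi>) X = subst \<sigma> (case_nat X \<rho>) \<phi>"
proof -
  have "(\<lambda>n. case_nat X id (case_nat 0 (\<lambda>n. Suc (\<rho> n)) n)) = case_nat X \<rho>"
    by (auto simp: fun_eq_iff split: nat.split)
  then show ?thesis by (simp add: inst_set_def subst_subst)
qed

text \<open>Dependence on variables is expressed through the effect of substitutions instead of a
  recursive set of free variables, with one bound for both sorts. The bound supplies fresh variables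
  and limits how often a formula has to be generalized.\<close>

definition vars_below :: "nat \<Rightarrow> fm \<Rightarrow> bool" where
  "vars_below N \<phi> \<longleftrightarrow> (\<forall>\<sigma> \<sigma>' \<rho> \<rho>'. (\<forall>n<N. \<sigma> n = \<sigma>' n) \<longrightarrow> (\<forall>n<N. \<rho> n = \<rho>' n) \<longrightarrow>
    subst \<sigma> \<rho> \<phi> = subst \<sigma>' \<rho>' \<phi>)"

lemma vars_belowD:
  "vars_below N \<phi> \<Longrightarrow> (\<And>n. n < N \<Longrightarrow> \<sigma> n = \<sigma>' n) \<Longrightarrow> (\<And>n. n < N \<Longrightarrow> \<rho> n = \<rho>' n) \<Longrightarrow>
    subst \<sigma> \<rho> \<phi> = subst \<sigma>' \<rho>' \<phi>"
  unfolding vars_below_def by blast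

lemma vars_below_mono: "vars_below N \<phi> \<Longrightarrow> N \<le> N' \<Longrightarrow> vars_below N' \<phi>"
  unfolding vars_below_def by (meson order_less_le_trans)

lemma all_less_max: "(\<forall>n<max M N. P n) \<longleftrightarrow> (\<forall>n<M. P n) \<and> (\<forall>n<N. P n)" for M N :: nat
  by (auto simp: less_max_iff_disj)

lemma subst_tm_bound: "\<exists>N. \<forall>\<sigma> \<sigma>'. (\<forall>n<N. \<sigma> n = \<sigma>' n) \<longrightarrow> subst_tm \<sigma> t = subst_tm \<sigma>' t"
proof (induction t)
  case (Add s t)
  then obtain M N where
    "\<forall>\<sigma> \<sigma>'. (\<forall>n<M. \<sigma> n = \<sigma>' n) \<longrightarrow> subst_tm \<sigma> s = subst_tm \<sigma>' s"
    "\<forall>\<sigma> \<sigma>'. (\<forall>n<N. \<sigma> n = \<sigma>' n) \<longrightarrow> subst_tm \<sigma> t = subst_tm \<sigma>' t" by blast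
  then show ?case by (intro exI[of _ "max M N"]) (auto simp: all_less_max)
next
  case (Mul s t)
  then obtain M N where
    "\<forall>\<sigma> \<sigma>'. (\<forall>n<M. \<sigma> n = \<sigma>' n) \<longrightarrow> subst_tm \<sigma> s = subst_tm \<sigma>' s"
    "\<forall>\<sigma> \<sigma>'. (\<forall>n<N. \<sigma> n = \<sigma>' n) \<longrightarrow> subst_tm \<sigma> t = subst_tm \<sigma>' t" by blast
  then show ?case by (intro exI[of _ "max M N"]) (auto simp: all_less_max)
qed (auto intro: exI[of _ "Suc _"])

lemma vars_below_All:
  assumes "vars_below (Suc N) \<phi>"
  shows "vars_below (Suc N) (All \<phi>)"
  unfolding vars_below_def
proof (intro allI impI)
  fix \<sigma> \<sigma>' :: "nat \<Rightarrow> tm" and \<rho> \<rho>' :: "nat \<Rightarrow> nat"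
  assume "\<forall>n<Suc N. \<sigma> n = \<sigma>' n" "\<forall>n<Suc N. \<rho> n = \<rho>' n"
  then show "subst \<sigma> \<rho> (All \<phi>) = subst \<sigma>' \<rho>' (All \<phi>)"
    by (auto intro!: vars_belowD[OF assms] split: nat.split)
qed

lemma vars_below_AllSet:
  assumes "vars_below (Suc N) \<phi>"
  shows "vars_below (Suc N) (AllSet \<phi>)"
  unfolding vars_below_def
proof (intro allI impI)
  fix \<sigma> \<sigma>' :: "nat \<Rightarrow> tm" and \<rho> \<rho>' :: "nat \<Rightarrow> nat"
  assume "\<forall>n<Suc N. \<sigma> n = \<sigma>' n" "\<forall>n<Suc N. \<rho> n = \<rho>' n"
  then show "subst \<sigma> \<rho> (AllSet \<phi>) = subst \<sigma>' \<rho>' (AllSet \<phi>)"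
    by (auto intro!: vars_belowD[OF assms] split: nat.split)
qed

lemma vars_below_exists: "\<exists>N. vars_below N \<phi>"
proof (induction \<phi>)
  case Falsum
  show ?case by (auto simp: vars_below_def)
next
  case (Eq s t)
  obtain M N where
    "\<forall>\<sigma> \<sigma>'. (\<forall>n<M. \<sigma> n = \<sigma>' n) \<longrightarrow> subst_tm \<sigma> s = subst_tm \<sigma>' s"
    "\<forall>\<sigma> \<sigma>'. (\<forall>n<N. \<sigma> n = \<sigma>' n) \<longrightarrow> subst_tm \<sigma> t = subst_tm \<sigma>' t" using subst_tm_bound[of s] subst_tm_bound[of t] by blast
  then show ?case
    unfolding vars_below_def by (intro exI[of _ "max M N"]) (auto simp: all_less_max)
next
  case (Less s t)
  obtain M N where
    "\<forall>\<sigma> \<sigma>'. (\<forall>n<M. \<sigma> n = \<sigma>' n) \<longrightarrow> subst_tm \<sigma> s = subst_tm \<sigma>' s"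
    "\<forall>\<sigma> \<sigma>'. (\<forall>n<N. \<sigma> n = \<sigma>' n) \<longrightarrow> subst_tm \<sigma> t = subst_tm \<sigma>' t" using subst_tm_bound[of s] subst_tm_bound[of t] by blast
  then show ?case
    unfolding vars_below_def by (intro exI[of _ "max M N"]) (auto simp: all_less_max)
next
  case (Mem t X)
  obtain N where
    "\<forall>\<sigma> \<sigma>'. (\<forall>n<N. \<sigma> n = \<sigma>' n) \<longrightarrow> subst_tm \<sigma> t = subst_tm \<sigma>' t" using subst_tm_bound[of t] by blast
  then show ?case
    unfolding vars_below_def
    by (intro exI[of _ "max N (Suc X)"]) (auto simp: all_less_max)
next
  case (Imp \<phi> \<psi>)
  then obtain M N where "vars_below M \<phi>" "vars_below N \<psi>" by blast
  then have "vars_below (max M N) \<phi>" "vars_below (max M N) \<psi>"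
    by (auto elim: vars_below_mono)
  then have "vars_below (max M N) (\<phi> \<^bold>\<longrightarrow> \<psi>)"
    unfolding vars_below_def subst.simps fm.inject by blast
  then show ?case ..
next
  case (All \<phi>)
  then show ?case by (meson vars_below_All vars_below_mono le_SucI order_refl)
next
  case (AllSet \<phi>)
  then show ?case by (meson vars_below_AllSet vars_below_mono le_SucI order_refl)
qed


section \<open>Derived rules of the calculus\<close>

text \<open>
  Closing a derivable formula under universal quantifiers and instantiating them again makes the
  derivable formulas closed under substitution, although \<open>T\<close> need not be.
\<close>

lemma derives_subst_num:
  assumes "T \<turnstile> \<phi>" "\<And>\<sigma> \<sigma>'. (\<And>n. n < N \<Longrightarrow> \<sigma> n = \<sigma>' n) \<Longrightarrow> subst \<sigma> id \<phi> = subst \<sigma>' id \<phi>"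
  shows "T \<turnstile> subst \<sigma> id \<phi>"
  using assms
proof (induction N arbitrary: \<phi> \<sigma>)
  case 0
  then have "subst \<sigma> id \<phi> = subst Var id \<phi>" by blast
  then show ?case using 0(1) by (simp only: subst_Var)
next
  case (Suc N)
  \<comment> \<open>The terms for the other variables go in while variable 0 is still bound, where
    they get shifted. Instantiating variable 0 by \<open>\<sigma> 0\<close> afterwards cannot touch
    them, so the result is a simultaneous substitution.\<close>
  have "T \<turnstile> subst (\<lambda>n. \<sigma> (Suc n)) id (All \<phi>)"
  proof (rule Suc.IH)
    show "T \<turnstile> All \<phi>" using Suc.prems(1) by (rule derives.Gen)
  next
    fix \<tau> \<tau>' :: "nat \<Rightarrow> tm" assume "\<And>n. n < N \<Longrightarrow> \<tau> n = \<tau>' n"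
    then show "subst \<tau> id (All \<phi>) = subst \<tau>' id (All \<phi>)"
      by (auto intro!: Suc.prems(2) split: nat.split)
  qed
  then have "T \<turnstile> inst (subst (case_nat (Var 0) (\<lambda>n. shift_tm (\<sigma> (Suc n)))) id \<phi>) (\<sigma> 0)"
    using derives.All_inst derives.MP unfolding subst.simps by blast
  moreover have "case_nat (\<sigma> 0) (\<lambda>n. \<sigma> (Suc n)) = \<sigma>" by (auto split: nat.split)
  ultimately show ?case by (simp only: inst_subst_All)
qed

lemma derives_subst_set:
  assumes "T \<turnstile> \<phi>" "\<And>\<rho> \<rho>'. (\<And>n. n < N \<Longrightarrow> \<rho> n = \<rho>' n) \<Longrightarrow> subst Var \<rho> \<phi> = subst Var \<rho>' \<phi>"
  shows "T \<turnstile> subst Var \<rho> \<phi>"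
  using assms
proof (induction N arbitrary: \<phi> \<rho>)
  case 0
  then have "subst Var \<rho> \<phi> = subst Var id \<phi>" by blast
  then show ?case using 0(1) by (simp only: subst_Var)
next
  case (Suc N)
  have "T \<turnstile> subst Var (\<lambda>n. \<rho> (Suc n)) (AllSet \<phi>)"
  proof (rule Suc.IH)
    show "T \<turnstile> AllSet \<phi>" using Suc.prems(1) by (rule derives.Gen_set)
  next
    fix \<pi> \<pi>' :: "nat \<Rightarrow> nat" assume "\<And>n. n < N \<Longrightarrow> \<pi> n = \<pi>' n"
    then show "subst Var \<pi> (AllSet \<phi>) = subst Var \<pi>' (AllSet \<phi>)"
      by (auto intro!: Suc.prems(2) split: nat.split)
  qed
  then have "T \<turnstile> inst_set (subst Var (case_nat 0 (\<lambda>n. Suc (\<rho> (Suc n)))) \<phi>) (\<rho> 0)"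
    using derives.AllSet_inst derives.MP unfolding subst.simps by blast
  moreover have "case_nat (\<rho> 0) (\<lambda>n. \<rho> (Suc n)) = \<rho>" by (auto split: nat.split)
  ultimately show ?case by (simp only: inst_set_subst_AllSet)
qed

text \<open>Replacing set variables and then number variables composes to the joint substitution.
  This makes axioms with free variables available at all terms and allows a fresh variable of a
  derivation to be renamed.\<close>

lemma derives_subst:
  assumes "T \<turnstile> \<phi>"
  shows "T \<turnstile> subst \<sigma> \<rho> \<phi>"
proof -
  obtain N where N: "vars_below N \<phi>" using vars_below_exists by blast
  have "T \<turnstile> subst Var \<rho> \<phi>"
    using assms by (rule derives_subst_set[of _ _ N]) (rule vars_belowD[OF N], auto)
  obtain M where M: "vars_below M (subst Var \<rho> \<phi>)" using vars_below_exists by blast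
  then have "T \<turnstile> subst \<sigma> id (subst Var \<rho> \<phi>)"
    by (intro derives_subst_num[of T _ M, OF \<open>T \<turnstile> subst Var \<rho> \<phi>\<close>] vars_belowD[OF M]) auto
  then show ?thesis by (simp add: subst_subst)
qed

text \<open>Hypotheses are combined by modus ponens only; generalization stays confined to
  derivations from \<open>T\<close>. The deduction theorem then holds without a condition on free
  variables.\<close>

inductive entails :: "fm set \<Rightarrow> fm set \<Rightarrow> fm \<Rightarrow> bool" for T G where
  hyp: "\<phi> \<in> G \<Longrightarrow> entails T G \<phi>"
| derivable: "T \<turnstile> \<phi> \<Longrightarrow> entails T G \<phi>"
| mp: "entails T G (\<phi> \<^bold>\<longrightarrow> \<psi>) \<Longrightarrow> entails T G \<phi> \<Longrightarrow> entails T G \<psi>"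

lemma derives_refl: "T \<turnstile> \<phi> \<^bold>\<longrightarrow> \<phi>"
  by (rule derives.MP[OF derives.MP[OF derives.S derives.K] derives.K[of T \<phi> \<phi>]])

lemma deduction:
  assumes "entails T (insert \<alpha> G) \<phi>"
  shows "entails T G (\<alpha> \<^bold>\<longrightarrow> \<phi>)"
  using assms
proof (induction rule: entails.induct)
  case (hyp \<phi>)
  then show ?case
    by (metis derives.K derives_refl entails.hyp entails.mp entails.derivable insertE)
next
  case (derivable \<phi>)
  then show ?case by (meson derives.K derives.MP entails.derivable)
next
  case (mp \<phi> \<psi>)
  then show ?case by (meson derives.S entails.derivable entails.mp)
qed

lemma entails_empty: "entails T {} \<phi> \<Longrightarrow> T \<turnstile> \<phi>"
  by (induction rule: entails.induct) (auto intro: derives.MP)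

lemma entails_singleton: "entails T {\<chi>} \<phi> \<longleftrightarrow> T \<turnstile> \<chi> \<^bold>\<longrightarrow> \<phi>"
  using deduction[of T \<chi> "{}"] entails_empty entails.mp entails.derivable entails.hyp
  by (meson singletonI)

lemma entails_mono: "entails T G \<phi> \<Longrightarrow> G \<subseteq> G' \<Longrightarrow> entails T G' \<phi>"
  by (induction rule: entails.induct) (auto intro: entails.intros)

lemma entails_contradiction:
  assumes "entails T (insert (\<^bold>\<not> \<phi>) G) Falsum"
  shows "entails T G \<phi>"
  using deduction[OF assms] derives.DNE entails.mp entails.derivable by blast

lemma entails_Falsum: "entails T G Falsum \<Longrightarrow> entails T G \<phi>"
  by (rule entails_contradiction) (auto elim: entails_mono)

lemma entails_And1: "entails T {\<phi> \<^bold>\<and> \<psi>} \<phi>"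
proof (rule entails_contradiction)
  let ?G = "{\<^bold>\<not> \<phi>, \<phi> \<^bold>\<and> \<psi>}"
  have "entails T (insert \<phi> ?G) (\<^bold>\<not> \<psi>)"
    by (rule entails_Falsum) (auto intro: entails.mp[of _ _ \<phi>] entails.hyp)
  then show "entails T ?G Falsum"
    using deduction entails.mp[of _ _ "\<phi> \<^bold>\<longrightarrow> \<^bold>\<not> \<psi>"] entails.hyp by (metis insertI1 insertI2)
qed

lemma entails_And2: "entails T {\<phi> \<^bold>\<and> \<psi>} \<psi>"
proof (rule entails_contradiction)
  let ?G = "{\<^bold>\<not> \<psi>, \<phi> \<^bold>\<and> \<psi>}"
  have "entails T (insert \<phi> ?G) (\<^bold>\<not> \<psi>)"
    by (rule entails.hyp) auto
  then show "entails T ?G Falsum"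
    using deduction entails.mp[of _ _ "\<phi> \<^bold>\<longrightarrow> \<^bold>\<not> \<psi>"] entails.hyp by (metis insertI1 insertI2)
qed

lemma entails_And_Falsum:
  assumes "entails T {\<phi> \<^bold>\<and> \<psi>} Falsum"
  shows "entails T {\<phi>} (\<^bold>\<not> \<psi>)"
proof -
  have "entails T {} (\<phi> \<^bold>\<longrightarrow> \<^bold>\<not> \<psi>)"
    by (rule entails_contradiction) (use assms in simp)
  then show ?thesis using entails_empty entails_singleton by blast
qed

lemma derives_All_fresh:
  assumes "T \<turnstile> \<chi> \<^bold>\<longrightarrow> inst \<theta> (Var k)" and k: "vars_below k \<chi>" "vars_below k \<theta>"
  shows "T \<turnstile> \<chi> \<^bold>\<longrightarrow> All \<theta>"
proof -
  let ?\<sigma> = "\<lambda>n. if n = k then Var 0 else Var (Suc n)"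
  have "T \<turnstile> subst ?\<sigma> id (\<chi> \<^bold>\<longrightarrow> inst \<theta> (Var k))" by (rule derives_subst[OF assms(1)])
  moreover have "subst ?\<sigma> id \<chi> = shift \<chi>"
    unfolding shift_def by (rule vars_belowD[OF k(1)]) auto
  moreover have "subst ?\<sigma> id (inst \<theta> (Var k)) = subst Var id \<theta>"
    unfolding inst_def subst_subst
    by (rule vars_belowD[OF k(2)]) (auto split: nat.split)
  ultimately have "T \<turnstile> shift \<chi> \<^bold>\<longrightarrow> \<theta>" by simp
  then show ?thesis using derives.Gen derives.All_imp derives.MP by blast
qed

lemma derives_AllSet_fresh:
  assumes "T \<turnstile> \<chi> \<^bold>\<longrightarrow> inst_set \<theta> k" and k: "vars_below k \<chi>" "vars_below k \<theta>"
  shows "T \<turnstile> \<chi> \<^bold>\<longrightarrow> AllSet \<theta>"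
proof -
  let ?\<rho> = "\<lambda>n. if n = k then 0 else Suc n"
  have "T \<turnstile> subst Var ?\<rho> (\<chi> \<^bold>\<longrightarrow> inst_set \<theta> k)" by (rule derives_subst[OF assms(1)])
  moreover have "subst Var ?\<rho> \<chi> = shift_set \<chi>"
    unfolding shift_set_def by (rule vars_belowD[OF k(1)]) auto
  moreover have "subst Var ?\<rho> (inst_set \<theta> k) = subst Var id \<theta>"
    unfolding inst_set_def subst_subst
    by (rule vars_belowD[OF k(2)]) (auto split: nat.split)
  ultimately have "T \<turnstile> shift_set \<chi> \<^bold>\<longrightarrow> \<theta>" by simp
  then show ?thesis using derives.Gen_set derives.AllSet_imp derives.MP by blast
qed


section \<open>Completeness\<close>

instance tm :: countable by countable_datatype
instance fm :: countable by countable_datatype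

text \<open>Witnesses are set variables and terms, which may contain free variables. Thus variables
  serve as the Henkin constants and the language is not extended.\<close>

locale henkin_theory =
  fixes T \<Gamma> :: "fm set"
  assumes derives: "T \<turnstile> \<phi> \<Longrightarrow> \<phi> \<in> \<Gamma>"
    and MP: "(\<phi> \<^bold>\<longrightarrow> \<psi>) \<in> \<Gamma> \<Longrightarrow> \<phi> \<in> \<Gamma> \<Longrightarrow> \<psi> \<in> \<Gamma>"
    and consistent: "Falsum \<notin> \<Gamma>"
    and complete: "\<phi> \<in> \<Gamma> \<or> (\<^bold>\<not> \<phi>) \<in> \<Gamma>"
    and All_witness: "All \<phi> \<notin> \<Gamma> \<Longrightarrow> \<exists>t. inst \<phi> t \<notin> \<Gamma>"
    and AllSet_witness: "AllSet \<phi> \<notin> \<Gamma> \<Longrightarrow> \<exists>X. inst_set \<phi> X \<notin> \<Gamma>"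

text \<open>All assumptions made so far are gathered in the single formula \<open>\<chi>\<close>, so
  only finitely many variables are in use and a fresh one is at hand. If \<open>\<psi>\<close> is
  quantified and has to be rejected, its instance at that variable is not provable from
  \<open>\<chi>\<close> either and can be denied as well.\<close>

lemma henkin_step:
  assumes "\<not> T \<turnstile> \<^bold>\<not> \<chi>"
  shows "\<exists>\<chi>'. \<not> T \<turnstile> \<^bold>\<not> \<chi>' \<and> T \<turnstile> \<chi>' \<^bold>\<longrightarrow> \<chi> \<and> (T \<turnstile> \<chi>' \<^bold>\<longrightarrow> \<psi> \<or> T \<turnstile> \<chi>' \<^bold>\<longrightarrow> \<^bold>\<not> \<psi> \<and>
    (\<forall>\<theta>. \<psi> = All \<theta> \<longrightarrow> (\<exists>t. T \<turnstile> \<chi>' \<^bold>\<longrightarrow> \<^bold>\<not> inst \<theta> t)) \<and>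
    (\<forall>\<theta>. \<psi> = AllSet \<theta> \<longrightarrow> (\<exists>X. T \<turnstile> \<chi>' \<^bold>\<longrightarrow> \<^bold>\<not> inst_set \<theta> X)))"
proof (cases "T \<turnstile> \<^bold>\<not> (\<chi> \<^bold>\<and> \<psi>)")
  case False
  then show ?thesis using entails_And1 entails_And2 entails_singleton by meson
next
  case True
  then have neg: "entails T {\<chi>} (\<^bold>\<not> \<psi>)" using entails_And_Falsum entails_singleton by blast
  \<comment> \<open>Any \<open>\<delta>\<close> not derivable from \<open>\<chi>\<close> may be
    denied consistently, and the stronger formula still refutes \<open>\<psi>\<close>. This is
    applied to the fresh instance, or to \<open>\<psi>\<close> itself if it is not
    quantified.\<close>
  have ext: "\<exists>\<chi>'. \<not> T \<turnstile> \<^bold>\<not> \<chi>' \<and> T \<turnstile> \<chi>' \<^bold>\<longrightarrow> \<chi> \<and> T \<turnstile> \<chi>' \<^bold>\<longrightarrow> \<^bold>\<not> \<psi> \<and> T \<turnstile> \<chi>' \<^bold>\<longrightarrow> \<^bold>\<not> \<delta>"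
    if "\<not> T \<turnstile> \<chi> \<^bold>\<longrightarrow> \<delta>" for \<delta>
  proof (intro exI conjI)
    let ?\<chi>' = "\<chi> \<^bold>\<and> \<^bold>\<not> \<delta>"
    show "\<not> T \<turnstile> \<^bold>\<not> ?\<chi>'"
    proof
      assume "T \<turnstile> \<^bold>\<not> ?\<chi>'"
      then have "entails T {\<chi>} (\<^bold>\<not> (\<^bold>\<not> \<delta>))" using entails_And_Falsum entails_singleton by blast
      then have "entails T {\<chi>} \<delta>" using derives.DNE entails.mp entails.derivable by blast
      then show False using that entails_singleton by blast
    qed
    show 1: "T \<turnstile> ?\<chi>' \<^bold>\<longrightarrow> \<chi>" and "T \<turnstile> ?\<chi>' \<^bold>\<longrightarrow> \<^bold>\<not> \<delta>"
      using entails_And1 entails_And2 entails_singleton by blast+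
    from 1 neg show "T \<turnstile> ?\<chi>' \<^bold>\<longrightarrow> \<^bold>\<not> \<psi>"
      by (meson entails_singleton entails.mp entails.derivable)
  qed
  have not\<psi>: "\<not> T \<turnstile> \<chi> \<^bold>\<longrightarrow> \<psi>"
    using neg assms entails.mp entails_singleton by blast
  \<comment> \<open>The \<open>case\<close> picks the body of a quantified \<open>\<psi>\<close>, so
    that one index \<open>k\<close> is fresh for either sort of quantifier.\<close>
  obtain N1 N2 where "vars_below N1 \<chi>" "vars_below N2 (case \<psi> of All \<theta> \<Rightarrow> \<theta> | AllSet \<theta> \<Rightarrow> \<theta> | _ \<Rightarrow> Falsum)"
    using vars_below_exists by blast
  then obtain k where k: "vars_below k \<chi>" "vars_below k (case \<psi> of All \<theta> \<Rightarrow> \<theta> | AllSet \<theta> \<Rightarrow> \<theta> | _ \<Rightarrow> Falsum)"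
    using vars_below_mono max.cobounded1 max.cobounded2 by meson
  consider \<theta> where "\<psi> = All \<theta>" | \<theta> where "\<psi> = AllSet \<theta>" | "\<nexists>\<theta>. \<psi> = All \<theta> \<or> \<psi> = AllSet \<theta>" by blast
  then show ?thesis
  proof cases
    case 1
    then have "\<not> T \<turnstile> \<chi> \<^bold>\<longrightarrow> inst \<theta> (Var k)" using derives_All_fresh not\<psi> k by auto
    from ext[OF this] 1 show ?thesis by blast
  next
    case 2
    then have "\<not> T \<turnstile> \<chi> \<^bold>\<longrightarrow> inst_set \<theta> k" using derives_AllSet_fresh not\<psi> k by auto
    from ext[OF this] 2 show ?thesis by blast
  next
    case 3
    then show ?thesis using ext[OF not\<psi>] by blast
  qed
qed

lemma henkin_extension:
  assumes "\<not> T \<turnstile> \<phi>"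
  shows "\<exists>\<Gamma>. henkin_theory T \<Gamma> \<and> \<phi> \<notin> \<Gamma>"
proof -
  define step where "step \<chi> \<psi> \<chi>' \<longleftrightarrow> T \<turnstile> \<chi>' \<^bold>\<longrightarrow> \<chi> \<and> (T \<turnstile> \<chi>' \<^bold>\<longrightarrow> \<psi> \<or> T \<turnstile> \<chi>' \<^bold>\<longrightarrow> \<^bold>\<not> \<psi> \<and>
    (\<forall>\<theta>. \<psi> = All \<theta> \<longrightarrow> (\<exists>t. T \<turnstile> \<chi>' \<^bold>\<longrightarrow> \<^bold>\<not> inst \<theta> t)) \<and>
    (\<forall>\<theta>. \<psi> = AllSet \<theta> \<longrightarrow> (\<exists>X. T \<turnstile> \<chi>' \<^bold>\<longrightarrow> \<^bold>\<not> inst_set \<theta> X)))" for \<chi> \<psi> \<chi>'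
  have "\<not> T \<turnstile> \<^bold>\<not> (\<^bold>\<not> \<phi>)" using assms derives.DNE derives.MP by blast
  \<comment> \<open>Every formula is \<open>from_nat n\<close> for some \<open>n\<close>, so the
    chain decides each formula at some stage. The clause for \<open>n = 0\<close> pins the start to
    the negation of \<open>\<phi>\<close>.\<close>
  then have "\<exists>c. \<forall>n. (\<not> T \<turnstile> \<^bold>\<not> (c n) \<and> (n = 0 \<longrightarrow> c n = (\<^bold>\<not> \<phi>))) \<and> step (c n) (from_nat n) (c (Suc n))"
    using henkin_step[of T] by (intro dependent_nat_choice) (blast, simp add: step_def)
  then obtain c where c0: "c 0 = (\<^bold>\<not> \<phi>)" and cons: "\<And>n. \<not> T \<turnstile> \<^bold>\<not> (c n)"
    and step: "\<And>n. step (c n) (from_nat n) (c (Suc n))" by blast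
  define \<Gamma> where "\<Gamma> = {\<psi>. \<exists>n. entails T {c n} \<psi>}"
  have mono: "entails T {c n} \<psi>" if "entails T {c m} \<psi>" "m \<le> n" for m n \<psi>
    using that(2,1)
  proof (induction rule: dec_induct)
    case (step n)
    then show ?case
      using \<open>\<And>n. step (c n) (from_nat n) (c (Suc n))\<close> unfolding step_def
      by (meson entails_singleton entails.mp entails.derivable)
  qed auto
  have mp: "\<psi> \<in> \<Gamma>" if "(\<theta> \<^bold>\<longrightarrow> \<psi>) \<in> \<Gamma>" "\<theta> \<in> \<Gamma>" for \<theta> \<psi>
  proof -
    obtain m n where "entails T {c m} (\<theta> \<^bold>\<longrightarrow> \<psi>)" "entails T {c n} \<theta>"
      using \<open>(\<theta> \<^bold>\<longrightarrow> \<psi>) \<in> \<Gamma>\<close> \<open>\<theta> \<in> \<Gamma>\<close> unfolding \<Gamma>_def by blast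
    then have "entails T {c (max m n)} (\<theta> \<^bold>\<longrightarrow> \<psi>)" "entails T {c (max m n)} \<theta>"
      by (auto elim: mono)
    then have "entails T {c (max m n)} \<psi>" by (rule entails.mp)
    then show ?thesis unfolding \<Gamma>_def by blast
  qed
  have consist: "Falsum \<notin> \<Gamma>" using cons unfolding \<Gamma>_def entails_singleton by blast
  have st: "\<psi> \<in> \<Gamma> \<or> (\<^bold>\<not> \<psi>) \<in> \<Gamma> \<and>
      (\<forall>\<theta>. \<psi> = All \<theta> \<longrightarrow> (\<exists>t. (\<^bold>\<not> inst \<theta> t) \<in> \<Gamma>)) \<and>
      (\<forall>\<theta>. \<psi> = AllSet \<theta> \<longrightarrow> (\<exists>X. (\<^bold>\<not> inst_set \<theta> X) \<in> \<Gamma>))" for \<psi>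
    using step[of "to_nat \<psi>"] unfolding step_def \<Gamma>_def entails_singleton from_nat_to_nat mem_Collect_eq
    by blast
  have "henkin_theory T \<Gamma>"
  proof
    show "\<psi> \<in> \<Gamma>" if "T \<turnstile> \<psi>" for \<psi> using that unfolding \<Gamma>_def by (blast intro: entails.derivable)
    show "\<psi> \<in> \<Gamma>" if "(\<theta> \<^bold>\<longrightarrow> \<psi>) \<in> \<Gamma>" "\<theta> \<in> \<Gamma>" for \<theta> \<psi> using mp that .
    show "Falsum \<notin> \<Gamma>" by (fact consist)
    show "\<psi> \<in> \<Gamma> \<or> (\<^bold>\<not> \<psi>) \<in> \<Gamma>" for \<psi> using st by blast
    show "\<exists>t. inst \<theta> t \<notin> \<Gamma>" if "All \<theta> \<notin> \<Gamma>" for \<theta> using st that mp consist by blast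
    show "\<exists>X. inst_set \<theta> X \<notin> \<Gamma>" if "AllSet \<theta> \<notin> \<Gamma>" for \<theta> using st that mp consist by blast
  qed
  moreover have "(\<^bold>\<not> \<phi>) \<in> \<Gamma>"
    unfolding \<Gamma>_def using c0 entails.hyp by (metis mem_Collect_eq singletonI)
  ultimately show ?thesis using mp consist by blast
qed


section \<open>Structures whose set quantifiers range over a given family of sets\<close>

locale interp =
  fixes zero :: 'a
    and succ :: "'a \<Rightarrow> 'a"
    and add :: "'a \<Rightarrow> 'a \<Rightarrow> 'a" (infixl "\<oplus>" 65)
    and mul :: "'a \<Rightarrow> 'a \<Rightarrow> 'a" (infixl "\<otimes>" 70)
    and less :: "'a \<Rightarrow> 'a \<Rightarrow> bool" (infix "\<lless>" 50)
    and sets :: "'a set set"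
begin

primrec val :: "(nat \<Rightarrow> 'a) \<Rightarrow> tm \<Rightarrow> 'a" where
  "val e (Var n) = e n"
| "val e Zero = zero"
| "val e (Succ t) = succ (val e t)"
| "val e (Add s t) = val e s \<oplus> val e t"
| "val e (Mul s t) = val e s \<otimes> val e t"

primrec sat :: "(nat \<Rightarrow> 'a) \<Rightarrow> (nat \<Rightarrow> 'a set) \<Rightarrow> fm \<Rightarrow> bool" where
  "sat e S Falsum \<longleftrightarrow> False"
| "sat e S (s \<^bold>= t) \<longleftrightarrow> val e s = val e t"
| "sat e S (s \<^bold>< t) \<longleftrightarrow> val e s \<lless> val e t"
| "sat e S (t \<^bold>\<in> X) \<longleftrightarrow> val e t \<in> S X"
| "sat e S (\<phi> \<^bold>\<longrightarrow> \<psi>) \<longleftrightarrow> (sat e S \<phi> \<longrightarrow> sat e S \<psi>)"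
| "sat e S (All \<phi>) \<longleftrightarrow> (\<forall>a. sat (case_nat a e) S \<phi>)"
| "sat e S (AllSet \<phi>) \<longleftrightarrow> (\<forall>A\<in>sets. sat e (case_nat A S) \<phi>)"

end

section \<open>Provable equality of terms, the basis of the term model\<close>

context henkin_theory
begin

lemma Imp_iff: "(\<phi> \<^bold>\<longrightarrow> \<psi>) \<in> \<Gamma> \<longleftrightarrow> (\<phi> \<in> \<Gamma> \<longrightarrow> \<psi> \<in> \<Gamma>)"
proof
  assume "\<phi> \<in> \<Gamma> \<longrightarrow> \<psi> \<in> \<Gamma>"
  then consider "(\<^bold>\<not> \<phi>) \<in> \<Gamma>" | "\<psi> \<in> \<Gamma>" using complete by blast
  then show "(\<phi> \<^bold>\<longrightarrow> \<psi>) \<in> \<Gamma>"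
  proof cases
    case 1
    have "entails T {\<phi>, \<^bold>\<not> \<phi>} \<psi>"
      by (rule entails_Falsum) (auto intro: entails.mp[of _ _ \<phi>] entails.hyp)
    then have "T \<turnstile> \<^bold>\<not> \<phi> \<^bold>\<longrightarrow> \<phi> \<^bold>\<longrightarrow> \<psi>" using deduction entails_singleton by blast
    then show ?thesis using 1 derives MP by blast
  next
    case 2
    then show ?thesis using derives[OF derives.K] MP by blast
  qed
qed (use MP in blast)

lemma All_iff: "All \<phi> \<in> \<Gamma> \<longleftrightarrow> (\<forall>t. inst \<phi> t \<in> \<Gamma>)"
  using All_witness derives[OF derives.All_inst] MP by blast

lemma AllSet_iff: "AllSet \<phi> \<in> \<Gamma> \<longleftrightarrow> (\<forall>X. inst_set \<phi> X \<in> \<Gamma>)"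
  using AllSet_witness derives[OF derives.AllSet_inst] MP by blast

definition eqv :: "tm \<Rightarrow> tm \<Rightarrow> bool" where
  "eqv s t \<longleftrightarrow> (s \<^bold>= t) \<in> \<Gamma>"

text \<open>The source of the congruence facts below: \<open>\<phi>\<close> is a template with
  variable 0 at the place to be changed, and all other terms in it are shifted so that instantiation
  leaves them alone.\<close>

lemma eqv_inst: "eqv s t \<Longrightarrow> inst \<phi> s \<in> \<Gamma> \<Longrightarrow> inst \<phi> t \<in> \<Gamma>"
  unfolding eqv_def using derives[OF derives.Eq_subst] MP by blast

lemma eqv_refl: "eqv t t"
  unfolding eqv_def by (rule derives[OF derives.Eq_refl])

lemma eqv_sym: "eqv s t \<Longrightarrow> eqv t s"
  using eqv_inst[of s t "Var 0 \<^bold>= shift_tm s"] eqv_refl[of s] by (simp add: inst_def eqv_def)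

lemma eqv_trans: "eqv s t \<Longrightarrow> eqv t u \<Longrightarrow> eqv s u"
  using eqv_inst[of t u "shift_tm s \<^bold>= Var 0"] by (simp add: inst_def eqv_def)

lemma eqv_Succ: "eqv s t \<Longrightarrow> eqv (Succ s) (Succ t)"
  using eqv_inst[of s t "Succ (shift_tm s) \<^bold>= Succ (Var 0)"] eqv_refl[of "Succ s"]
  by (simp add: inst_def eqv_def)

lemma eqv_Add: "eqv s t \<Longrightarrow> eqv s' t' \<Longrightarrow> eqv (Add s s') (Add t t')"
  using eqv_inst[of s t "Add (shift_tm s) (shift_tm s') \<^bold>= Add (Var 0) (shift_tm s')"]
    eqv_inst[of s' t' "Add (shift_tm s) (shift_tm s') \<^bold>= Add (shift_tm t) (Var 0)"]
    eqv_refl[of "Add s s'"]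
  by (simp add: inst_def eqv_def)

lemma eqv_Mul: "eqv s t \<Longrightarrow> eqv s' t' \<Longrightarrow> eqv (Mul s s') (Mul t t')"
  using eqv_inst[of s t "Mul (shift_tm s) (shift_tm s') \<^bold>= Mul (Var 0) (shift_tm s')"]
    eqv_inst[of s' t' "Mul (shift_tm s) (shift_tm s') \<^bold>= Mul (shift_tm t) (Var 0)"]
    eqv_refl[of "Mul s s'"]
  by (simp add: inst_def eqv_def)

lemma eqv_Less: "eqv s t \<Longrightarrow> eqv s' t' \<Longrightarrow> (s \<^bold>< s') \<in> \<Gamma> \<Longrightarrow> (t \<^bold>< t') \<in> \<Gamma>"
  using eqv_inst[of s t "Var 0 \<^bold>< shift_tm s'"] eqv_inst[of s' t' "shift_tm t \<^bold>< Var 0"]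
  by (simp add: inst_def)

lemma eqv_Mem: "eqv s t \<Longrightarrow> (s \<^bold>\<in> X) \<in> \<Gamma> \<Longrightarrow> (t \<^bold>\<in> X) \<in> \<Gamma>"
  using eqv_inst[of s t "Var 0 \<^bold>\<in> X"] by (simp add: inst_def)

text \<open>Descent along \<open>Succ\<close> by the two axioms on successors. Its purpose is to
  make the term model infinite.\<close>

lemma eqv_numeral:
  assumes "Robinson \<subseteq> T" "eqv ((Succ ^^ m) Zero) ((Succ ^^ n) Zero)"
  shows "m = n"
proof -
  have "T \<turnstile> \<^bold>\<not> Succ (Var 0) \<^bold>= Zero" "T \<turnstile> Succ (Var 0) \<^bold>= Succ (Var 1) \<^bold>\<longrightarrow> Var 0 \<^bold>= Var 1"
    using assms(1) by (auto simp: Robinson_def intro: derives.Axiom)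
  note this[THEN derives_subst, THEN derives]
  note ax = this(1)[of "\<lambda>_. s" for s] this(2)[of "case_nat s (\<lambda>_. t)" for s t]
  have "\<not> eqv (Succ s) Zero" for s using ax(1)[of s] MP consistent by (auto simp: eqv_def)
  moreover have "eqv s t" if "eqv (Succ s) (Succ t)" for s t
    using ax(2)[of s t] that MP by (auto simp: eqv_def)
  ultimately show ?thesis using assms(2)
  proof (induction m arbitrary: n)
    case 0
    then show ?case by (cases n) (auto dest: eqv_sym)
  next
    case (Suc m)
    then show ?case by (cases n) auto
  qed
qed

text \<open>There are only countably many terms, hence classes, and infinitely many classes because
  the numerals lie in different ones. A bijection of the classes with \<open>nat\<close> then lets
  the term model live on \<open>nat\<close>.\<close>

lemma enumerate_eqv_classes:
  assumes "Robinson \<subseteq> T"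
  obtains h :: "tm \<Rightarrow> nat" where "surj h" "\<And>s t. h s = h t \<longleftrightarrow> eqv s t"
proof -
  let ?c = "\<lambda>t. {s. eqv t s}"
  have c: "?c s = ?c t \<longleftrightarrow> eqv s t" for s t
    using eqv_refl eqv_sym eqv_trans by blast
  have "inj (\<lambda>n. ?c ((Succ ^^ n) Zero))"
    by (rule injI) (use c eqv_numeral[OF assms] in simp)
  then have "infinite (range (\<lambda>n. ?c ((Succ ^^ n) Zero)))" by (rule range_inj_infinite)
  moreover have "range (\<lambda>n. ?c ((Succ ^^ n) Zero)) \<subseteq> range ?c" by blast
  ultimately have "infinite (range ?c)" using infinite_super by blast
  then have bij: "bij_betw (to_nat_on (range ?c)) (range ?c) UNIV"
    by (intro to_nat_on_infinite) auto
  show thesis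
  proof
    show "surj (\<lambda>t. to_nat_on (range ?c) (?c t))"
      using bij by (simp add: bij_betw_def image_image)
    show "to_nat_on (range ?c) (?c s) = to_nat_on (range ?c) (?c t) \<longleftrightarrow> eqv s t" for s t
      using inj_on_eq_iff[OF bij_betw_imp_inj_on[OF bij] rangeI rangeI, of s t] c[of s t] by (rule trans)
  qed
qed

end

theorem completeness:
  assumes "Robinson \<subseteq> T"
    and valid: "\<And>(zero :: nat) succ add mul less sets e S.
      (\<And>\<psi> e S. \<psi> \<in> T \<Longrightarrow> range S \<subseteq> sets \<Longrightarrow> interp.sat zero succ add mul less sets e S \<psi>) \<Longrightarrow>
      range S \<subseteq> sets \<Longrightarrow> interp.sat zero succ add mul less sets e S \<phi>"
  shows "T \<turnstile> \<phi>"
proof (rule ccontr)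
  assume "\<not> T \<turnstile> \<phi>"
  then obtain \<Gamma> where "henkin_theory T \<Gamma>" and \<phi>: "\<phi> \<notin> \<Gamma>" using henkin_extension by blast
  then interpret henkin_theory T \<Gamma> by simp
  obtain h :: "tm \<Rightarrow> nat" where "surj h" and h: "\<And>s t. h s = h t \<longleftrightarrow> eqv s t"
    using enumerate_eqv_classes[OF assms(1)] by blast
  define g where "g = inv h"
  have hg [simp]: "h (g a) = a" for a unfolding g_def using \<open>surj h\<close> by (rule surj_f_inv_f)
  then have gh: "eqv (g (h t)) t" for t using h by blast
  then have gh_Mem: "(g (h t) \<^bold>\<in> X) \<in> \<Gamma> \<longleftrightarrow> (t \<^bold>\<in> X) \<in> \<Gamma>" for t X
    using eqv_sym eqv_Mem by blast
  have all_h: "(\<forall>a. P a) \<longleftrightarrow> (\<forall>t. P (h t))" for P by (metis hg)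
  \<comment> \<open>Different set variables may receive the same extension. This is harmless because
    sets enter atomic formulas only through membership.\<close>
  define ext where "ext X = {a. (g a \<^bold>\<in> X) \<in> \<Gamma>}" for X
  interpret interp "h Zero" "\<lambda>a. h (Succ (g a))" "\<lambda>a b. h (Add (g a) (g b))"
    "\<lambda>a b. h (Mul (g a) (g b))" "\<lambda>a b. (g a \<^bold>< g b) \<in> \<Gamma>" "range ext" .
  have val: "val (\<lambda>n. h (\<sigma> n)) t = h (subst_tm \<sigma> t)" for \<sigma> t
    by (induction t) (auto simp: h intro: eqv_Succ eqv_Add eqv_Mul gh)
  \<comment> \<open>The truth lemma, for assignments given by terms and set variables. In the
    quantifier cases, adding \<open>h t\<close> or \<open>ext X\<close> to an assignment amounts to
    adding \<open>t\<close> to \<open>\<sigma>\<close> or \<open>X\<close> to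
    \<open>\<rho>\<close>.\<close>
  have truth: "sat (\<lambda>n. h (\<sigma> n)) (\<lambda>n. ext (\<rho> n)) \<psi> \<longleftrightarrow> subst \<sigma> \<rho> \<psi> \<in> \<Gamma>" for \<sigma> \<rho> \<psi>
  proof (induction \<psi> arbitrary: \<sigma> \<rho>)
    case Falsum
    then show ?case using consistent by simp
  next
    case (Eq s t)
    then show ?case by (simp add: val h eqv_def)
  next
    case (Less s t)
    then show ?case using gh eqv_sym eqv_Less by (simp add: val) blast
  next
    case (Mem t X)
    have "a \<in> ext Y \<longleftrightarrow> (g a \<^bold>\<in> Y) \<in> \<Gamma>" for a Y by (simp add: ext_def)
    then show ?case by (simp add: val gh_Mem)
  next
    case (Imp \<psi> \<chi>)
    then show ?case by (simp add: Imp_iff)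
  next
    case (All \<psi>)
    have *: "case_nat (h t) (\<lambda>n. h (\<sigma> n)) = (\<lambda>n. h (case_nat t \<sigma> n))" for t
      by (auto simp: fun_eq_iff split: nat.split)
    have "sat (\<lambda>n. h (\<sigma> n)) (\<lambda>n. ext (\<rho> n)) (All \<psi>) \<longleftrightarrow>
        (\<forall>t. sat (case_nat (h t) (\<lambda>n. h (\<sigma> n))) (\<lambda>n. ext (\<rho> n)) \<psi>)"
      by (simp add: all_h)
    also have "\<dots> \<longleftrightarrow> (\<forall>t. subst (case_nat t \<sigma>) \<rho> \<psi> \<in> \<Gamma>)"
      unfolding * All.IH ..
    finally show ?case by (simp add: All_iff inst_subst_All)
  next
    case (AllSet \<psi>)
    have *: "case_nat (ext X) (\<lambda>n. ext (\<rho> n)) = (\<lambda>n. ext (case_nat X \<rho> n))" for X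
      by (auto simp: fun_eq_iff split: nat.split)
    have "sat (\<lambda>n. h (\<sigma> n)) (\<lambda>n. ext (\<rho> n)) (AllSet \<psi>) \<longleftrightarrow>
        (\<forall>X. sat (\<lambda>n. h (\<sigma> n)) (case_nat (ext X) (\<lambda>n. ext (\<rho> n))) \<psi>)"
      by simp
    also have "\<dots> \<longleftrightarrow> (\<forall>X. subst \<sigma> (case_nat X \<rho>) \<psi> \<in> \<Gamma>)"
      unfolding * AllSet.IH ..
    finally show ?case by (simp add: AllSet_iff inst_set_subst_AllSet)
  qed
  have "sat (\<lambda>n. h (Var n)) (\<lambda>n. ext (id n)) \<phi>"
  proof (rule valid)
    fix \<psi> and e :: "nat \<Rightarrow> nat" and S :: "nat \<Rightarrow> nat set"
    assume "\<psi> \<in> T" "range S \<subseteq> range ext"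
    \<comment> \<open>Every assignment into this structure comes from a substitution, so it is
      enough that all substitution instances of an axiom are derivable.\<close>
    then obtain \<rho> where "S = (\<lambda>n. ext (\<rho> n))"
      unfolding image_subset_iff by (metis UNIV_I f_inv_into_f)
    moreover have "e = (\<lambda>n. h (g (e n)))" by simp
    ultimately show "sat e S \<psi>"
      using truth \<open>\<psi> \<in> T\<close> derives[OF derives_subst[OF derives.Axiom]] by metis
  qed auto
  then show False using \<phi> by (simp only: truth subst_Var)
qed


section \<open>Models of arithmetic\<close>

context interp
begin

lemma val_shift_tm [simp]: "val (case_nat a e) (shift_tm t) = val e t"
  unfolding shift_tm_def by (induction t) auto

lemma val_subst_tm: "val e (subst_tm \<sigma> t) = val (\<lambda>n. val e (\<sigma> n)) t"
  by (induction t) auto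

lemma sat_subst: "sat e S (subst \<sigma> \<rho> \<phi>) \<longleftrightarrow> sat (\<lambda>n. val e (\<sigma> n)) (\<lambda>n. S (\<rho> n)) \<phi>"
proof (induction \<phi> arbitrary: e S \<sigma> \<rho>)
  case (All \<phi>)
  have "(\<lambda>n. val (case_nat a e) (case_nat (Var 0) (\<lambda>n. shift_tm (\<sigma> n)) n)) = case_nat a (\<lambda>n. val e (\<sigma> n))" for a
    by (auto simp: fun_eq_iff split: nat.split)
  then show ?case by (simp add: All)
next
  case (AllSet \<phi>)
  have "(\<lambda>n. case_nat A S (case_nat 0 (\<lambda>n. Suc (\<rho> n)) n)) = case_nat A (\<lambda>n. S (\<rho> n))" for A
    by (auto simp: fun_eq_iff split: nat.split)
  then show ?case by (simp add: AllSet)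
qed (auto simp: val_subst_tm)

lemma sat_BAll [simp]: "sat e S (BAll t \<phi>) \<longleftrightarrow> (\<forall>a. a \<lless> val e t \<longrightarrow> sat (case_nat a e) S \<phi>)"
  by (simp add: BAll_def)

lemma sat_BEx [simp]: "sat e S (BEx t \<phi>) \<longleftrightarrow> (\<exists>a. a \<lless> val e t \<and> sat (case_nat a e) S \<phi>)"
  by (simp add: BEx_def)

end

lemma bounded_Sigma0: "bounded \<phi> \<Longrightarrow> Sigma0 1 \<phi>"
  by (simp add: Sigma0_Pi0.intros)

lemma bounded_Pi0: "bounded \<phi> \<Longrightarrow> Pi0 1 \<phi>"
  by (simp add: Sigma0_Pi0.intros)

text \<open>Axioms hold under every assignment because their free variables stand for parameters. An
  assignment has to send set variables somewhere, so even the arithmetical axioms become accessible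
  only once \<open>sets\<close> is nonempty.\<close>

locale RCA0_model = interp zero succ add mul less sets
  for zero :: 'a
    and succ :: "'a \<Rightarrow> 'a"
    and add :: "'a \<Rightarrow> 'a \<Rightarrow> 'a" (infixl "\<oplus>" 65)
    and mul :: "'a \<Rightarrow> 'a \<Rightarrow> 'a" (infixl "\<otimes>" 70)
    and less :: "'a \<Rightarrow> 'a \<Rightarrow> bool" (infix "\<lless>" 50)
    and sets :: "'a set set" +
  assumes RCA0: "\<phi> \<in> RCA0 \<Longrightarrow> range S \<subseteq> sets \<Longrightarrow> sat e S \<phi>"
    and sets_nonempty: "sets \<noteq> {}"
begin

lemma induct:
  assumes "Sigma0 1 \<phi>" "range S \<subseteq> sets" "sat (case_nat zero e) S \<phi>"
    and "\<And>a. sat (case_nat a e) S \<phi> \<Longrightarrow> sat (case_nat (succ a) e) S \<phi>"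
  shows "sat (case_nat a e) S \<phi>"
proof -
  have "sat e S (induction \<phi>)"
    using assms(1,2) by (intro RCA0) (auto simp: RCA0_def)
  moreover have "(\<lambda>n. val e (case_nat Zero Var n)) = case_nat zero e"
    by (auto simp: fun_eq_iff split: nat.split)
  moreover have "(\<lambda>n. val (case_nat a e) (case_nat (Succ (Var 0)) (\<lambda>n. Var (Suc n)) n)) = case_nat (succ a) e" for a
    by (auto simp: fun_eq_iff split: nat.split)
  ultimately show ?thesis using assms(3,4) by (simp add: induction_def inst_def sat_subst)
qed

text \<open>A bounded formula is both \<open>\<Sigma>\<^sub>1\<close> and
  \<open>\<Pi>\<^sub>1\<close>, so it can stand on both sides of the equivalence in the
  scheme.\<close>

lemma comprehension:
  assumes "bounded \<phi>" "range S \<subseteq> sets"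
  obtains H where "H \<in> sets" "\<And>a. a \<in> H \<longleftrightarrow> sat (case_nat a e) S \<phi>"
proof -
  have "sat e S (Delta_comprehension \<phi> \<phi>)"
    using assms bounded_Sigma0[of \<phi>] bounded_Pi0[of \<phi>] unfolding RCA0_def by (intro RCA0[unfolded RCA0_def]) blast+
  then have "\<exists>H\<in>sets. \<forall>a. a \<in> H \<longleftrightarrow> sat (case_nat a e) S \<phi>"
    by (auto simp: Delta_comprehension_def shift_set_def sat_subst)
  then show thesis using that by blast
qed

text \<open>Meant for formulas without set variables, whose truth does not depend on
  \<open>S\<close>. With \<open>S\<close> quantified away, the simplifier reduces an instance
  directly to a law of the model; parameters of the law are passed through \<open>e\<close>.\<close>

lemma open_induct:
  assumes "bounded \<phi>" "\<And>S. sat (case_nat zero e) S \<phi>"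
    and "\<And>a S. sat (case_nat a e) S \<phi> \<Longrightarrow> sat (case_nat (succ a) e) S \<phi>"
  shows "\<exists>S. sat (case_nat a e) S \<phi>"
proof -
  obtain A where "A \<in> sets" using sets_nonempty by blast
  then show ?thesis
    using induct[of \<phi> "\<lambda>_. A"] bounded_Sigma0 assms by (intro exI[of _ "\<lambda>_. A"]) auto
qed

lemma robinson:
  shows succ_neq_zero [simp]: "succ a \<noteq> zero"
    and succ_inject [simp]: "succ a = succ b \<longleftrightarrow> a = b"
    and pred_exists: "a \<noteq> zero \<Longrightarrow> \<exists>b. a = succ b"
    and add_zero [simp]: "a \<oplus> zero = a"
    and add_succ [simp]: "a \<oplus> succ b = succ (a \<oplus> b)"
    and mul_zero [simp]: "a \<otimes> zero = zero"
    and mul_succ [simp]: "a \<otimes> succ b = a \<otimes> b \<oplus> a"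
    and less_iff: "a \<lless> b \<longleftrightarrow> (\<exists>d. succ d \<oplus> a = b)"
proof -
  obtain A where "A \<in> sets" using sets_nonempty by blast
  then have "sat (case_nat a (\<lambda>_. b)) (\<lambda>_. A) \<phi>" if "\<phi> \<in> Robinson" for \<phi> a b
    using that by (intro RCA0) (auto simp: RCA0_def)
  note ax = this[unfolded Robinson_def]
  show "succ a \<noteq> zero" using ax[of "\<^bold>\<not> Succ (Var 0) \<^bold>= Zero" a b] by simp
  show "succ a = succ b \<longleftrightarrow> a = b"
    using ax[of "Succ (Var 0) \<^bold>= Succ (Var 1) \<^bold>\<longrightarrow> Var 0 \<^bold>= Var 1" a b] by auto
  show "a \<noteq> zero \<Longrightarrow> \<exists>b. a = succ b"
    using ax[of "\<^bold>\<not> Var 0 \<^bold>= Zero \<^bold>\<longrightarrow> Ex (Var 1 \<^bold>= Succ (Var 0))" a b] by auto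
  show "a \<oplus> zero = a" using ax[of "Add (Var 0) Zero \<^bold>= Var 0" a b] by simp
  show "a \<oplus> succ b = succ (a \<oplus> b)"
    using ax[of "Add (Var 0) (Succ (Var 1)) \<^bold>= Succ (Add (Var 0) (Var 1))" a b] by simp
  show "a \<otimes> zero = zero" using ax[of "Mul (Var 0) Zero \<^bold>= Zero" a b] by simp
  show "a \<otimes> succ b = a \<otimes> b \<oplus> a"
    using ax[of "Mul (Var 0) (Succ (Var 1)) \<^bold>= Add (Mul (Var 0) (Var 1)) (Var 0)" a b] by simp
  show "a \<lless> b \<longleftrightarrow> (\<exists>d. succ d \<oplus> a = b)"
    using ax[of "Var 0 \<^bold>< Var 1 \<^bold>\<longleftrightarrow> Ex (Add (Succ (Var 0)) (Var 1) \<^bold>= Var 2)" a b]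
    by (auto simp: numeral_eq_Suc)
qed

lemmas zero_neq_succ [simp] = succ_neq_zero[symmetric]

lemmas num_simps = bounded.intros numeral_eq_Suc

section \<open>Semiring and order laws\<close>

lemma zero_add [simp]: "zero \<oplus> a = a"
  using open_induct[of "Add Zero (Var 0) \<^bold>= Var 0" "\<lambda>_. a" a] by (simp add: num_simps)

lemma succ_add [simp]: "succ b \<oplus> a = succ (b \<oplus> a)"
  using open_induct[of "Add (Succ (Var 1)) (Var 0) \<^bold>= Succ (Add (Var 1) (Var 0))" "\<lambda>_. b" a]
  by (simp add: num_simps)

lemma add_assoc: "a \<oplus> b \<oplus> c = a \<oplus> (b \<oplus> c)"
  using open_induct[of "Add (Add (Var 1) (Var 2)) (Var 0) \<^bold>= Add (Var 1) (Add (Var 2) (Var 0))"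
      "case_nat a (\<lambda>_. b)" c]
  by (simp add: num_simps)

lemma add_comm: "a \<oplus> b = b \<oplus> a"
  using open_induct[of "Add (Var 1) (Var 0) \<^bold>= Add (Var 0) (Var 1)" "\<lambda>_. a" b] by (simp add: num_simps)

lemma add_left_comm: "a \<oplus> (b \<oplus> c) = b \<oplus> (a \<oplus> c)"
  by (metis add_assoc add_comm)

lemmas add_ac = add_assoc add_comm add_left_comm

lemma zero_mul [simp]: "zero \<otimes> a = zero"
  using open_induct[of "Mul Zero (Var 0) \<^bold>= Zero" "\<lambda>_. a" a] by (simp add: num_simps)

lemma succ_mul [simp]: "succ b \<otimes> a = b \<otimes> a \<oplus> a"
  using open_induct[of "Mul (Succ (Var 1)) (Var 0) \<^bold>= Add (Mul (Var 1) (Var 0)) (Var 0)" "\<lambda>_. b" a]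
  by (simp add: num_simps add_ac)

lemma mul_comm: "a \<otimes> b = b \<otimes> a"
  using open_induct[of "Mul (Var 1) (Var 0) \<^bold>= Mul (Var 0) (Var 1)" "\<lambda>_. a" b] by (simp add: num_simps)

lemma mul_add: "a \<otimes> (b \<oplus> c) = a \<otimes> b \<oplus> a \<otimes> c"
  using open_induct[of "Mul (Var 1) (Add (Var 2) (Var 0)) \<^bold>= Add (Mul (Var 1) (Var 2)) (Mul (Var 1) (Var 0))"
      "case_nat a (\<lambda>_. b)" c]
  by (simp add: num_simps add_assoc)

lemma add_mul: "(b \<oplus> c) \<otimes> a = b \<otimes> a \<oplus> c \<otimes> a"
  by (metis mul_add mul_comm)

lemma mul_assoc: "a \<otimes> b \<otimes> c = a \<otimes> (b \<otimes> c)"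
  using open_induct[of "Mul (Mul (Var 1) (Var 2)) (Var 0) \<^bold>= Mul (Var 1) (Mul (Var 2) (Var 0))"
      "case_nat a (\<lambda>_. b)" c]
  by (simp add: num_simps mul_add)

lemma mul_left_comm: "a \<otimes> (b \<otimes> c) = b \<otimes> (a \<otimes> c)"
  by (metis mul_assoc mul_comm)

lemma add_right_cancel [simp]: "a \<oplus> c = b \<oplus> c \<longleftrightarrow> a = b"
  using open_induct[of "Add (Var 1) (Var 0) \<^bold>= Add (Var 2) (Var 0) \<^bold>\<longrightarrow> Var 1 \<^bold>= Var 2"
      "case_nat a (\<lambda>_. b)" c]
  by (auto simp: num_simps)

lemma add_left_cancel [simp]: "c \<oplus> a = c \<oplus> b \<longleftrightarrow> a = b"
  by (metis add_comm add_right_cancel)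

lemma add_eq_zero [simp]: "a \<oplus> b = zero \<longleftrightarrow> a = zero \<and> b = zero"
proof (cases "b = zero")
  case False
  then obtain c where "b = succ c" using pred_exists by blast
  then show ?thesis by simp
qed simp

lemma mul_eq_zero [simp]: "a \<otimes> b = zero \<longleftrightarrow> a = zero \<or> b = zero"
proof (cases "b = zero")
  case False
  then obtain c where "b = succ c" using pred_exists by blast
  then show ?thesis by auto
qed simp

lemma not_less_zero [simp]: "\<not> a \<lless> zero"
  by (simp add: less_iff)

lemma less_succ_iff: "a \<lless> succ b \<longleftrightarrow> a \<lless> b \<or> a = b"
proof
  assume "a \<lless> succ b"
  then obtain d where "d \<oplus> a = b" by (auto simp: less_iff)
  then show "a \<lless> b \<or> a = b" by (cases "d = zero") (auto simp: less_iff dest: pred_exists)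
qed (auto simp: less_iff intro: exI[of _ zero] exI[of _ "succ _"])

lemma less_trans: "a \<lless> b \<Longrightarrow> b \<lless> c \<Longrightarrow> a \<lless> c"
  unfolding less_iff by (metis add_assoc succ_add add_succ)

lemma less_cases: "a \<lless> b \<or> a = b \<or> b \<lless> a"
proof -
  let ?\<phi> = "Var 0 \<^bold>< Var 1 \<^bold>\<or> Var 0 \<^bold>= Var 1 \<^bold>\<or> Var 1 \<^bold>< Var 0"
  have step: "succ a \<lless> b \<or> succ a = b \<or> b \<lless> succ a" if "a \<lless> b \<or> a = b \<or> b \<lless> a" for a
  proof (cases "a \<lless> b")
    case True
    then obtain d where "succ d \<oplus> a = b" by (auto simp: less_iff)
    then show ?thesis by (cases "d = zero") (auto simp: less_iff dest: pred_exists)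
  next
    case False
    then show ?thesis using that by (auto simp: less_succ_iff)
  qed
  have base: "zero \<lless> b \<or> zero = b" by (cases "b = zero") (auto simp: less_iff dest: pred_exists)
  have "\<exists>S. sat (case_nat a (\<lambda>_. b)) S ?\<phi>"
  proof (rule open_induct)
    show "bounded ?\<phi>" by (intro bounded.intros)
    show "sat (case_nat zero (\<lambda>_. b)) S ?\<phi>" for S
      using base by (simp only: sat.simps val.simps nat.case One_nat_def) blast
    show "sat (case_nat (succ a) (\<lambda>_. b)) S ?\<phi>" if "sat (case_nat a (\<lambda>_. b)) S ?\<phi>" for a S
    proof -
      have "a \<lless> b \<or> a = b \<or> b \<lless> a"
        using that by (simp only: sat.simps val.simps nat.case One_nat_def) blast
      from step[OF this] show ?thesis
        by (simp only: sat.simps val.simps nat.case One_nat_def) blast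
    qed
  qed
  then show ?thesis by (simp only: sat.simps val.simps nat.case One_nat_def) blast
qed

text \<open>If there were no least element, "nothing below \<open>a\<close> satisfies
  \<open>P\<close>" would be a bounded inductive property. Index 1 of \<open>\<phi>\<close> is taken
  by the bound of the quantifier in that property and must not affect its truth, whence the
  arbitrary \<open>a\<close>; parameters start at index 2.\<close>

lemma least:
  assumes "bounded \<phi>" "range S \<subseteq> sets" "\<And>c a. sat (case_nat c (case_nat a e)) S \<phi> \<longleftrightarrow> P c" "P b"
  shows "\<exists>c. P c \<and> (\<forall>c'. c' \<lless> c \<longrightarrow> \<not> P c')"
proof (rule ccontr)
  assume *: "\<not> ?thesis"
  let ?\<psi> = "BAll (Var 0) (\<^bold>\<not> \<phi>)"
  have sat: "sat (case_nat a e) S ?\<psi> \<longleftrightarrow> (\<forall>c. c \<lless> a \<longrightarrow> \<not> P c)" for a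
    by (simp add: assms(3))
  have "bounded ?\<psi>" using assms(1) by (intro bounded.intros)
  have "sat (case_nat (succ b) e) S ?\<psi>"
  proof (rule induct)
    show "Sigma0 1 ?\<psi>" using \<open>bounded ?\<psi>\<close> by (rule bounded_Sigma0)
    show "sat (case_nat zero e) S ?\<psi>" unfolding sat by simp
    show "sat (case_nat (succ a) e) S ?\<psi>" if "sat (case_nat a e) S ?\<psi>" for a
    proof -
      from that have "\<forall>c. c \<lless> a \<longrightarrow> \<not> P c" unfolding sat .
      moreover from this have "\<not> P a" using * by blast
      ultimately show ?thesis unfolding sat less_succ_iff by blast
    qed
  qed (rule assms(2))
  then show False unfolding sat using \<open>P b\<close> less_succ_iff by blast
qed


section \<open>Divisibility and codes of finite sets\<close>

definition dv :: "'a \<Rightarrow> 'a \<Rightarrow> bool" (infix "dv" 50) where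
  "a dv b \<longleftrightarrow> (\<exists>d. a \<otimes> d = b)"

lemma dv_mul: "a dv b \<Longrightarrow> a dv c \<otimes> b"
  unfolding dv_def by (metis mul_left_comm)

lemma dv_mul_self: "a dv c \<otimes> a"
  unfolding dv_def by (metis mul_comm)

lemma dv_self_mul: "a dv a \<otimes> c"
  unfolding dv_def by blast

text \<open>Subtraction is replaced by a comparison of cofactors: either their difference is a
  cofactor of \<open>y\<close>, or the cofactor of \<open>x\<close> is at least the other one and
  \<open>y\<close> must be \<open>zero\<close>.\<close>

lemma dv_add_cancel:
  assumes "a dv x" "a dv x \<oplus> y"
  shows "a dv y"
proof -
  obtain s t where s: "a \<otimes> s = x" and t: "a \<otimes> t = x \<oplus> y" using assms by (auto simp: dv_def)
  show ?thesis
  proof (cases "s \<lless> t")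
    case True
    then obtain u where "t = s \<oplus> u" unfolding less_iff by (metis add_comm)
    then have "a \<otimes> u = y" using s t by (simp add: mul_add)
    then show ?thesis by (auto simp: dv_def)
  next
    case False
    then obtain u where "s = t \<oplus> u" using less_cases[of s t] unfolding less_iff by (metis add_comm add_zero)
    then have "x = x \<oplus> (y \<oplus> a \<otimes> u)" using s t by (simp add: mul_add add_assoc)
    then have "y = zero" by (metis add_zero add_left_cancel add_eq_zero)
    then show ?thesis by (auto simp: dv_def intro: exI[of _ zero])
  qed
qed

text \<open>Limiting the cofactor by the dividend is what makes divisibility a bounded formula, as
  minimization and comprehension require.\<close>

lemma succ_dv_iff: "succ a dv b \<longleftrightarrow> (\<exists>d. d \<lless> succ b \<and> succ a \<otimes> d = b)"
proof
  assume "succ a dv b"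
  then obtain d where d: "a \<otimes> d \<oplus> d = b" by (auto simp: dv_def)
  then have "d \<lless> succ b" by (auto simp: less_iff)
  with d show "\<exists>d. d \<lless> succ b \<and> succ a \<otimes> d = b" by auto
qed (auto simp: dv_def)

text \<open>Goedel's moduli: they are pairwise coprime for indices below \<open>l\<close> if all of \<open>1, \<dots>, l\<close> divide \<open>m\<close>.\<close>

definition modulus :: "'a \<Rightarrow> 'a \<Rightarrow> 'a" where
  "modulus m i = succ (succ i \<otimes> m)"

lemma modulus_neq_zero: "modulus m i \<noteq> zero"
  unfolding modulus_def by (rule succ_neq_zero)

text \<open>In effect \<open>m\<close> is invertible modulo \<open>modulus m i\<close>: the sum
  \<open>succ i \<otimes> (m \<otimes> a) \<oplus> a\<close> is \<open>modulus m i\<close> times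
  \<open>a\<close>, and its first summand is divisible by assumption.\<close>

lemma modulus_dv_cancel:
  assumes "modulus m i dv m \<otimes> a"
  shows "modulus m i dv a"
proof (rule dv_add_cancel)
  show "modulus m i dv succ i \<otimes> (m \<otimes> a)" by (rule dv_mul[OF assms])
  show "modulus m i dv succ i \<otimes> (m \<otimes> a) \<oplus> a"
    by (auto simp: dv_def modulus_def add_mul mul_assoc intro: exI[of _ a])
qed

text \<open>With \<open>m = succ d \<otimes> r\<close>, the factor \<open>m\<close> is cancelled,
  multiplication by \<open>r\<close> turns \<open>succ d\<close> into a second \<open>m\<close>, and
  that one is cancelled too.\<close>

lemma modulus_dv_mul_cancel:
  assumes "succ d dv m" "modulus m i dv succ d \<otimes> m \<otimes> a"
  shows "modulus m i dv a"
proof -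
  obtain r where r: "succ d \<otimes> r = m" using assms(1) by (auto simp: dv_def)
  have "modulus m i dv m \<otimes> (succ d \<otimes> a)"
    using assms(2) by (metis mul_assoc mul_comm)
  then have "modulus m i dv r \<otimes> (succ d \<otimes> a)" by (rule dv_mul[OF modulus_dv_cancel])
  also have "r \<otimes> (succ d \<otimes> a) = m \<otimes> a" by (metis r mul_assoc mul_comm)
  finally show ?thesis by (rule modulus_dv_cancel)
qed

lemma modulus_add: "modulus m (succ d \<oplus> i) = modulus m i \<oplus> succ d \<otimes> m"
  by (simp add: modulus_def add_mul add_ac)

text \<open>The two moduli differ by \<open>succ d \<otimes> m\<close> with \<open>d\<close> below
  \<open>l\<close>, so \<open>succ d\<close> divides \<open>m\<close> and the difference can be
  cancelled. Stating coprimality as cancellation avoids primes and Bezout coefficients.\<close>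

lemma modulus_coprime:
  assumes m: "\<And>i. i \<lless> l \<Longrightarrow> succ i dv m" and ij: "i \<lless> l" "j \<lless> l" "i \<noteq> j"
    and "modulus m i dv modulus m j \<otimes> a"
  shows "modulus m i dv a"
proof -
  have less: "d \<lless> l" if "succ d \<oplus> k \<lless> l" for d k
  proof -
    have "d \<lless> succ d \<oplus> k" unfolding less_iff by (metis add_comm succ_add add_succ)
    then show ?thesis using that less_trans by blast
  qed
  from less_cases[of i j] ij(3) consider d where "j = succ d \<oplus> i" | d where "i = succ d \<oplus> j"
    unfolding less_iff by blast
  then show ?thesis
  proof cases
    case 1
    have "modulus m j \<otimes> a = a \<otimes> modulus m i \<oplus> succ d \<otimes> m \<otimes> a"
      by (simp only: 1 modulus_add add_mul mul_comm[of a])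
    then have "modulus m i dv succ d \<otimes> m \<otimes> a"
      using assms(5) dv_mul_self dv_add_cancel by metis
    then show ?thesis using 1 less m ij modulus_dv_mul_cancel by blast
  next
    case 2
    have "modulus m i dv modulus m j \<otimes> a \<oplus> succ d \<otimes> m \<otimes> a"
      using dv_mul_self[of "modulus m i" a]
      by (simp only: 2 modulus_add add_mul mul_comm[of a])
    then have "modulus m i dv succ d \<otimes> m \<otimes> a" using assms(5) dv_add_cancel by blast
    then show ?thesis using 2 less m ij modulus_dv_mul_cancel by blast
  qed
qed

end

section \<open>Existence of the common multiples and of the codes\<close>

definition Dvd :: "tm \<Rightarrow> tm \<Rightarrow> fm" where
  "Dvd s t = BEx (Succ t) (Mul (shift_tm s) (Var 0) \<^bold>= shift_tm t)"

lemma bounded_Dvd: "bounded (Dvd s t)"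
  unfolding Dvd_def by (intro bounded.intros)

context RCA0_model
begin

lemma sat_Dvd [simp]: "sat e S (Dvd (Succ s) t) \<longleftrightarrow> succ (val e s) dv val e t"
  unfolding Dvd_def succ_dv_iff by (auto simp del: succ_mul)

text \<open>In effect the factorial of \<open>l\<close>: each step multiplies by
  \<open>succ k\<close>. The induction carries only the existence of a multiple, a
  \<open>\<Sigma>\<^sub>1\<close> statement, so no sequence of partial products has to be coded.
  Asking for a nonzero one excludes the trivial multiple.\<close>

lemma common_multiple:
  obtains m where "m \<noteq> zero" "\<And>i. i \<lless> l \<Longrightarrow> succ i dv m"
proof -
  obtain A where A: "A \<in> sets" using sets_nonempty by blast
  let ?\<phi> = "Ex (\<^bold>\<not> Var 0 \<^bold>= Zero \<^bold>\<and> BAll (Var 1) (Dvd (Succ (Var 0)) (Var 1)))"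
  have sat: "sat (case_nat k (\<lambda>_. l)) (\<lambda>_. A) ?\<phi> \<longleftrightarrow> (\<exists>m. m \<noteq> zero \<and> (\<forall>i. i \<lless> k \<longrightarrow> succ i dv m))" for k
    by simp
  have "sat (case_nat l (\<lambda>_. l)) (\<lambda>_. A) ?\<phi>"
  proof (rule induct)
    have "bounded (\<^bold>\<not> Var 0 \<^bold>= Zero \<^bold>\<and> BAll (Var 1) (Dvd (Succ (Var 0)) (Var 1)))"
      by (intro bounded.intros bounded_Dvd)
    then show "Sigma0 1 ?\<phi>" using bounded_Sigma0 by (simp add: Sigma0_Pi0.intros)
    show "sat (case_nat zero (\<lambda>_. l)) (\<lambda>_. A) ?\<phi>"
      unfolding sat using succ_neq_zero not_less_zero by blast
  next
    fix k assume "sat (case_nat k (\<lambda>_. l)) (\<lambda>_. A) ?\<phi>"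
    then obtain m where "m \<noteq> zero" "\<forall>i. i \<lless> k \<longrightarrow> succ i dv m" unfolding sat by blast
    then have "succ k \<otimes> m \<noteq> zero" "\<forall>i. i \<lless> succ k \<longrightarrow> succ i dv succ k \<otimes> m"
      unfolding less_succ_iff mul_eq_zero using succ_neq_zero dv_mul dv_self_mul by blast+
    then show "sat (case_nat (succ k) (\<lambda>_. l)) (\<lambda>_. A) ?\<phi>" unfolding sat by blast
  qed (use A in auto)
  then show thesis using that unfolding sat by blast
qed

text \<open>The same induction with the moduli as factors. The resulting \<open>C\<close> is the
  common bound for the codes of all colours.\<close>

lemma common_multiple_modulus:
  obtains C where "C \<noteq> zero" "\<And>i. i \<lless> l \<Longrightarrow> modulus m i dv C"
proof -
  obtain A where A: "A \<in> sets" using sets_nonempty by blast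
  let ?\<phi> = "Ex (\<^bold>\<not> Var 0 \<^bold>= Zero \<^bold>\<and> BAll (Var 1) (Dvd (Succ (Mul (Succ (Var 0)) (Var 3))) (Var 1)))"
  have sat: "sat (case_nat k (\<lambda>_. m)) (\<lambda>_. A) ?\<phi> \<longleftrightarrow> (\<exists>C. C \<noteq> zero \<and> (\<forall>i. i \<lless> k \<longrightarrow> modulus m i dv C))" for k
    by (simp add: modulus_def numeral_eq_Suc)
  have "sat (case_nat l (\<lambda>_. m)) (\<lambda>_. A) ?\<phi>"
  proof (rule induct)
    have "bounded (\<^bold>\<not> Var 0 \<^bold>= Zero \<^bold>\<and> BAll (Var 1) (Dvd (Succ (Mul (Succ (Var 0)) (Var 3))) (Var 1)))"
      by (intro bounded.intros bounded_Dvd)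
    then show "Sigma0 1 ?\<phi>" using bounded_Sigma0 by (simp add: Sigma0_Pi0.intros)
    show "sat (case_nat zero (\<lambda>_. m)) (\<lambda>_. A) ?\<phi>"
      unfolding sat using succ_neq_zero not_less_zero by blast
  next
    fix k assume "sat (case_nat k (\<lambda>_. m)) (\<lambda>_. A) ?\<phi>"
    then obtain C where "C \<noteq> zero" "\<forall>i. i \<lless> k \<longrightarrow> modulus m i dv C" unfolding sat by blast
    then have "modulus m k \<otimes> C \<noteq> zero" "\<forall>i. i \<lless> succ k \<longrightarrow> modulus m i dv modulus m k \<otimes> C"
      unfolding less_succ_iff mul_eq_zero using modulus_neq_zero dv_mul dv_self_mul by blast+
    then show "sat (case_nat (succ k) (\<lambda>_. m)) (\<lambda>_. A) ?\<phi>" unfolding sat by blast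
  qed (use A in auto)
  then show thesis using that unfolding sat by blast
qed

definition pr :: "'a \<Rightarrow> 'a \<Rightarrow> 'a" where
  "pr k x = (k \<oplus> x) \<otimes> (k \<oplus> x) \<oplus> k"

lemma val_pair [simp]: "val e (pair s t) = pr (val e s) (val e t)"
  by (simp add: pair_def pr_def)

text \<open>
  The code of a set is the least common multiple \<open>c\<close> of the moduli of its members.  A further modulus
  dividing \<open>c\<close> could be cancelled from \<open>c\<close> by coprimality, contradicting minimality.
\<close>

lemma code_exists:
  assumes R: "R \<in> sets" and m: "m \<noteq> zero" "\<And>i. i \<lless> l \<Longrightarrow> succ i dv m"
    and C: "C \<noteq> zero" "\<And>i. i \<lless> l \<Longrightarrow> modulus m i dv C"
  obtains c where "c \<lless> succ C" "\<And>i. i \<lless> l \<Longrightarrow> pr i x \<in> R \<longleftrightarrow> modulus m i dv c"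
proof -
  let ?P = "\<lambda>c. c \<noteq> zero \<and> (\<forall>i. i \<lless> l \<longrightarrow> pr i x \<in> R \<longrightarrow> modulus m i dv c)"
  let ?\<phi> = "\<^bold>\<not> Var 0 \<^bold>= Zero \<^bold>\<and> BAll (Var 2) (pair (Var 0) (Var 4) \<^bold>\<in> 0 \<^bold>\<longrightarrow>
    Dvd (Succ (Mul (Succ (Var 0)) (Var 5))) (Var 1))"
  have "\<exists>c. ?P c \<and> (\<forall>c'. c' \<lless> c \<longrightarrow> \<not> ?P c')"
  proof (rule least)
    show "bounded ?\<phi>" by (intro bounded.intros bounded_Dvd)
    show "range (\<lambda>_. R) \<subseteq> sets" using R by auto
    show "sat (case_nat c (case_nat a (case_nat l (case_nat x (\<lambda>_. m))))) (\<lambda>_. R) ?\<phi> \<longleftrightarrow> ?P c" for c a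
      by (auto simp: modulus_def numeral_eq_Suc)
    show "?P C" using C by auto
  qed
  then obtain c where c: "?P c" and least: "\<And>c'. c' \<lless> c \<Longrightarrow> \<not> ?P c'" by blast
  show thesis
  proof
    \<comment> \<open>\<open>C\<close> meets the minimized condition whatever \<open>x\<close> is,
      so the minimum is at most \<open>C\<close>.\<close>
    show "c \<lless> succ C" using least[of C] C less_cases[of c C] by (auto simp: less_succ_iff)
    show "pr j x \<in> R \<longleftrightarrow> modulus m j dv c" if j: "j \<lless> l" for j
    proof
      assume dv: "modulus m j dv c"
      show "pr j x \<in> R"
      proof (rule ccontr)
        assume "pr j x \<notin> R"
        obtain a where a: "modulus m j \<otimes> a = c" using dv by (auto simp: dv_def)
        then have "a \<noteq> zero" using c by auto
        \<comment> \<open>The moduli required to divide \<open>c\<close> belong to indices other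
          than \<open>j\<close>, so they still divide the quotient \<open>a\<close>.\<close>
        have "modulus m i dv a" if "i \<lless> l" "pr i x \<in> R" for i
        proof (rule modulus_coprime[OF m(2)])
          show "modulus m i dv modulus m j \<otimes> a" using a c that by blast
        qed (use that j \<open>pr j x \<notin> R\<close> in auto)
        then have "?P a" using \<open>a \<noteq> zero\<close> by blast
        moreover have "a \<lless> c"
        proof -
          \<comment> \<open>A nonzero \<open>m\<close> makes the modulus exceed 1, so the quotient
            is strictly smaller than \<open>c\<close>.\<close>
          have "succ j \<otimes> m \<otimes> a \<noteq> zero" using m(1) \<open>a \<noteq> zero\<close> by (auto simp del: succ_mul)
          then obtain d where "succ j \<otimes> m \<otimes> a = succ d" using pred_exists by blast
          then have "succ d \<oplus> a = c" using a by (simp add: modulus_def)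
          then show ?thesis unfolding less_iff by blast
        qed
        ultimately show False using least by blast
      qed
    qed (use c j in blast)
  qed
qed

end


section \<open>Finite cohesiveness\<close>

locale RCA0_BSigma2_model = RCA0_model +
  assumes BSigma2: "\<phi> \<in> BSigma0 2 \<Longrightarrow> range S \<subseteq> sets \<Longrightarrow> sat e S \<phi>"
begin

lemma collection:
  assumes "Sigma0 2 \<phi>" "range S \<subseteq> sets"
    and "\<And>x. x \<lless> a \<Longrightarrow> \<exists>y. sat (case_nat y (case_nat x e)) S \<phi>"
  obtains b where "\<And>x. x \<lless> a \<Longrightarrow> \<exists>y. y \<lless> b \<and> sat (case_nat y (case_nat x e)) S \<phi>"
proof -
  have "sat e S (collection \<phi>)"
    using assms(1,2) by (intro BSigma2) (auto simp: BSigma0_def)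
  moreover have "(\<lambda>n. val (case_nat y (case_nat x (case_nat a e))) (Var (if n < 2 then n else n + 1)))
      = case_nat y (case_nat x e)" for y x a
    by (auto simp: fun_eq_iff split: nat.split)
  moreover have "(\<lambda>n. val (case_nat y (case_nat x (case_nat b (case_nat a e)))) (Var (if n < 2 then n else n + 2)))
      = case_nat y (case_nat x e)" for y x a b
    by (auto simp: fun_eq_iff split: nat.split)
  ultimately have "\<exists>b. \<forall>x. x \<lless> a \<longrightarrow> (\<exists>y. y \<lless> b \<and> sat (case_nat y (case_nat x e)) S \<phi>)"
    using assms(3) by (simp add: collection_def sat_subst)
  then show thesis using that by blast
qed

lemma cohesive_set_exists:
  assumes R: "R \<in> sets"
  obtains H where "H \<in> sets" "\<And>a. \<exists>x. a \<lless> x \<and> x \<in> H"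
    "\<And>k. k \<lless> l \<Longrightarrow> (\<forall>x\<in>H. pr k x \<in> R) \<or> (\<forall>x\<in>H. pr k x \<notin> R)"
proof -
  obtain m where m: "m \<noteq> zero" "\<And>i. i \<lless> l \<Longrightarrow> succ i dv m" using common_multiple[of l] by blast
  obtain C where C: "C \<noteq> zero" "\<And>i. i \<lless> l \<Longrightarrow> modulus m i dv C" using common_multiple_modulus[of l m] by blast
  define code where "code c x \<longleftrightarrow> (\<forall>i. i \<lless> l \<longrightarrow> (pr i x \<in> R \<longleftrightarrow> modulus m i dv c))" for c x
  have SR: "range (\<lambda>_. R) \<subseteq> sets" using R by auto
  have "\<exists>c. c \<lless> succ C \<and> (\<forall>a. \<exists>x. a \<lless> x \<and> code c x)"
  proof (rule ccontr)
    assume neg: "\<not> ?thesis"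
    let ?\<psi> = "Var 1 \<^bold>< Var 0 \<^bold>\<longrightarrow> \<^bold>\<not> BAll (Var 3) (pair (Var 0) (Var 1) \<^bold>\<in> 0 \<^bold>\<longleftrightarrow>
      Dvd (Succ (Mul (Succ (Var 0)) (Var 5))) (Var 3))"
    have sat: "sat (case_nat a (case_nat c (case_nat l (\<lambda>_. m)))) (\<lambda>_. R) (All ?\<psi>) \<longleftrightarrow>
        (\<forall>x. a \<lless> x \<longrightarrow> \<not> code c x)" for a c
      by (auto simp: code_def modulus_def numeral_eq_Suc)
    have "bounded ?\<psi>" by (intro bounded.intros bounded_Dvd)
    then have "Pi0 1 (All ?\<psi>)" using bounded_Pi0 by (simp add: Sigma0_Pi0.intros)
    \<comment> \<open>A \<open>\<Pi>\<^sub>1\<close> formula counts as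
      \<open>\<Sigma>\<^sub>2\<close>; the existential quantifier over the bound \<open>a\<close> is
      the one that the collection scheme itself supplies.\<close>
    then have "Sigma0 2 (All ?\<psi>)" by (metis Sigma0_Pi0.intros(2) Suc_1)
    then obtain b where b: "\<And>c. c \<lless> succ C \<Longrightarrow> \<exists>a. a \<lless> b \<and> (\<forall>x. a \<lless> x \<longrightarrow> \<not> code c x)"
      using collection[OF _ SR, of "All ?\<psi>" "succ C" "case_nat l (\<lambda>_. m)"] neg unfolding sat by blast
    \<comment> \<open>The number \<open>b\<close> itself gives the contradiction: the individual
      bounds are all below \<open>b\<close>, so it should have no code.\<close>
    obtain c where "c \<lless> succ C" "\<And>i. i \<lless> l \<Longrightarrow> pr i b \<in> R \<longleftrightarrow> modulus m i dv c"
      by (rule code_exists[OF R, of m l C b]) (use m C in blast)+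
    then have "c \<lless> succ C" "code c b" unfolding code_def by blast+
    then show False using b by blast
  qed
  then obtain c where c: "\<And>a. \<exists>x. a \<lless> x \<and> code c x" by blast
  \<comment> \<open>With \<open>c\<close> fixed as a parameter, having code \<open>c\<close> is a
    bounded condition.\<close>
  let ?\<phi> = "BAll (Var 2) (pair (Var 0) (Var 1) \<^bold>\<in> 0 \<^bold>\<longleftrightarrow>
    Dvd (Succ (Mul (Succ (Var 0)) (Var 4))) (Var 2))"
  have "bounded ?\<phi>" by (intro bounded.intros bounded_Dvd)
  then obtain H where H: "H \<in> sets"
    "\<And>x. x \<in> H \<longleftrightarrow> sat (case_nat x (case_nat c (case_nat l (\<lambda>_. m)))) (\<lambda>_. R) ?\<phi>"
    using comprehension[OF _ SR] by blast
  have "x \<in> H \<longleftrightarrow> code c x" for x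
    unfolding H(2) by (auto simp: code_def modulus_def numeral_eq_Suc)
  then show thesis using that[OF H(1)] c unfolding code_def by blast
qed

lemma sat_FinCOH: "sat e S FinCOH"
proof -
  have "sat e S FinCOH \<longleftrightarrow> (\<forall>l. \<forall>R\<in>sets. \<exists>H\<in>sets.
      (\<forall>a. \<exists>x. a \<lless> x \<and> x \<in> H) \<and> (\<forall>k. k \<lless> l \<longrightarrow>
        (\<exists>b. \<forall>x. x \<in> H \<longrightarrow> b \<lless> x \<longrightarrow> pr k x \<in> R) \<or> (\<exists>b. \<forall>x. x \<in> H \<longrightarrow> b \<lless> x \<longrightarrow> pr k x \<notin> R)))"
    by (simp add: FinCOH_def infinite_set_def almost_subset_def numeral_eq_Suc)
  also have "\<dots>"
  proof (intro allI ballI)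
    fix l R assume "R \<in> sets"
    then obtain H where "H \<in> sets" "\<And>a. \<exists>x. a \<lless> x \<and> x \<in> H"
      "\<And>k. k \<lless> l \<Longrightarrow> (\<forall>x\<in>H. pr k x \<in> R) \<or> (\<forall>x\<in>H. pr k x \<notin> R)"
      using cohesive_set_exists by blast
    \<comment> \<open>Homogeneity holds without exceptions, so any \<open>b\<close> can serve in the
      almost inclusions.\<close>
    then show "\<exists>H\<in>sets. (\<forall>a. \<exists>x. a \<lless> x \<and> x \<in> H) \<and> (\<forall>k. k \<lless> l \<longrightarrow>
        (\<exists>b. \<forall>x. x \<in> H \<longrightarrow> b \<lless> x \<longrightarrow> pr k x \<in> R) \<or> (\<exists>b. \<forall>x. x \<in> H \<longrightarrow> b \<lless> x \<longrightarrow> pr k x \<notin> R))"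
      by blast
  qed
  finally show ?thesis .
qed

end

theorem proposition3p4: "RCA0 \<union> BSigma0 2 \<turnstile> FinCOH"
proof (rule completeness)
  show "Robinson \<subseteq> RCA0 \<union> BSigma0 2" by (auto simp: RCA0_def)
next
  fix zero :: nat and succ add mul less sets and e :: "nat \<Rightarrow> nat" and S :: "nat \<Rightarrow> nat set"
  assume "\<And>\<psi> e S. \<psi> \<in> RCA0 \<union> BSigma0 2 \<Longrightarrow> range S \<subseteq> sets \<Longrightarrow>
    interp.sat zero succ add mul less sets e S \<psi>" and "range S \<subseteq> sets"
  \<comment> \<open>Nonemptiness of \<open>sets\<close> comes from the range of the assignment
    \<open>S\<close>.\<close>
  then interpret RCA0_BSigma2_model zero succ add mul less sets
    by unfold_locales auto
  show "sat e S FinCOH" by (rule sat_FinCOH)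
qed

end
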